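(* Let $q\ge3$ be an integer, $p\in[0,1]$, and $\lambda=1-\frac{pq}{q-1}$. Let $\mathbf{d}$ be a random variable on the nonnegative integers with mean $\bar d$ and maximum possible value $d_{max}$. For $n\ge1$ let $x_n=\mathbb{E}[Y^+(n)]$ and $z_n=\mathbb{E}[Y^+(n)^2]$ as defined in the context. Then for every $n$, $$x_{n+1}\le\bar d\lambda^2x_n+\sum_{j=2}^{d_{max}}\mathbb{E}\Big[\binom{\mathbf{d}}{j}\Big]\lambda^{2j}\Big[\frac{2(q-1)}{q^2}\Big(\frac{q(q-3+\lambda)}{q-1}x_n-\frac{q^2\lambda}{q-1}z_n\Big)^j$$ $$+\frac{(q-1)(q-2)}{q^2}\Big(-\frac{q(3q-6+2\lambda)}{(q-1)(q-2)}x_n+\frac{2q^2\lambda}{(q-1)(q-2)}z_n\Big)^j-\frac{2(q-1)}{q}\Big(-\frac{q}{q-1}x_n\Big)^j\Big].$$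
   Context: Potts channel: on the alphabet $D=\{1,\dots,q\}$, $M_{i,j}=1-p$ if $i=j$ and $M_{i,j}=\frac{p}{q-1}$ otherwise. Let $T$ be a random rooted tree (Galton–Watson) in which the number of children of every vertex is an independent copy of $\mathbf{d}$. Given $T$, colors are broadcast: the root $\rho$ gets a color $\sigma_\rho$ (uniform on $D$), and for each vertex $v$ with parent $u$, $\sigma_v$ is drawn from the row $M_{\sigma_u,\cdot}$, independently over edges. Let $L(n)$ be the configuration on the vertices at level $n$ (distance $n$ from the root), and $L^a(n)$ its distribution conditioned on $\sigma_\rho=a$. Define $X^+(n)=\mathbb{P}(\sigma_\rho=a\mid L(n)=L)$ where $L$ is drawn from $L^a(n)$ (this does not depend on $a$ by symmetry), and $Y^+(n)=X^+(n)-\frac1q$. Expectations $\mathbb{E}$ are over both the random tree and the broadcast process. *)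

theory Defs
  imports "HOL-Probability.Probability"
begin

section \<open>The Potts channel\<close>

definition potts_matrix :: "nat \<Rightarrow> real \<Rightarrow> nat \<Rightarrow> nat \<Rightarrow> real" where
  "potts_matrix q p i j = (if i = j then 1 - p else p / (real q - 1))"

definition potts_row :: "nat \<Rightarrow> real \<Rightarrow> nat \<Rightarrow> nat pmf" where
  "potts_row q p i = embed_pmf (\<lambda>j. if j \<in> {1..q} then potts_matrix q p i j else 0)"

text \<open>\<^const>\<open>embed_pmf\<close> is only meaningful if its argument is nonnegative and sums to 1;
  this is the case for all colours:\<close>

lemma pmf_potts_row:
  assumes "2 \<le> q" "0 \<le> p" "p \<le> 1" "i \<in> {1..q}"
  shows "pmf (potts_row q p i) j = (if j \<in> {1..q} then potts_matrix q p i j else 0)"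
proof -
  define f where "f j = (if j \<in> {1..q} then potts_matrix q p i j else 0)" for j
  have nonneg: "f j \<ge> 0" for j
    using assms by (auto simp: f_def potts_matrix_def)
  have "(\<integral>\<^sup>+ j. ennreal (f j) \<partial>count_space UNIV) = (\<Sum>j\<in>{1..q}. ennreal (f j))"
    by (rule nn_integral_count_space'[of "{1..q}"]) (auto simp: f_def)
  also have "\<dots> = ennreal (\<Sum>j\<in>{1..q}. f j)"
    using nonneg by (simp add: sum_ennreal)
  also have "(\<Sum>j\<in>{1..q}. f j) = f i + (\<Sum>j\<in>{1..q} - {i}. f j)"
    using assms by (intro sum.remove) auto
  also have "(\<Sum>j\<in>{1..q} - {i}. f j) = (\<Sum>j\<in>{1..q} - {i}. p / (real q - 1))"
    by (intro sum.cong) (auto simp: f_def potts_matrix_def)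
  also have "\<dots> = p"
    using assms by (simp add: of_nat_diff)
  also have "f i = 1 - p"
    using assms by (simp add: f_def potts_matrix_def)
  finally have total: "(\<integral>\<^sup>+ j. ennreal (f j) \<partial>count_space UNIV) = 1"
    by simp
  have "pmf (potts_row q p i) j = f j"
    unfolding potts_row_def f_def[symmetric]
    using pmf_embed_pmf[of f, OF nonneg total] by simp
  then show ?thesis
    by (simp add: f_def)
qed


section \<open>Galton--Watson trees\<close>

text \<open>
  A rooted tree is given in Ulam--Harris form: \<^term>\<open>c :: nat list \<Rightarrow> nat\<close> assigns to each
  potential vertex its number of children, the root is the empty list, and the children of \<open>v\<close>
  are \<open>v @ [0], \<dots>, v @ [c v - 1]\<close>; so the parent of a vertex is given by \<^const>\<open>butlast\<close>.
  The numbers \<open>c v\<close> for lists \<open>v\<close> that are not vertices of the tree are irrelevant.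
\<close>

primrec level :: "(nat list \<Rightarrow> nat) \<Rightarrow> nat \<Rightarrow> nat list set" where
  "level c 0 = {[]}"
| "level c (Suc n) = {v @ [i] | v i. v \<in> level c n \<and> i < c v}"

lemma finite_level: "finite (level c n)"
proof (induction n)
  case (Suc n)
  have "level c (Suc n) = (\<Union>v\<in>level c n. (\<lambda>i. v @ [i]) ` {..<c v})"
    by auto
  then show ?case
    using Suc by simp
qed simp

definition galton_watson :: "nat pmf \<Rightarrow> (nat list \<Rightarrow> nat) measure" where
  "galton_watson d = (\<Pi>\<^sub>M v\<in>UNIV. measure_pmf d)"


section \<open>The broadcast process on a fixed tree\<close>

text \<open>Joint law of the colours of all vertices at distance at most \<open>n\<close> from the root.\<close>

primrec broadcast :: "nat \<Rightarrow> real \<Rightarrow> (nat list \<Rightarrow> nat) \<Rightarrow> nat \<Rightarrow> (nat list \<Rightarrow> nat) pmf" where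
  "broadcast q p c 0 = map_pmf (\<lambda>s. (\<lambda>v. undefined)([] := s)) (pmf_of_set {1..q})"
| "broadcast q p c (Suc n) =
     bind_pmf (broadcast q p c n) (\<lambda>\<sigma>.
       map_pmf (\<lambda>\<tau>. override_on \<sigma> \<tau> (level c (Suc n)))
         (Pi_pmf (level c (Suc n)) undefined (\<lambda>v. potts_row q p (\<sigma> (butlast v)))))"

definition level_config ::
    "(nat list \<Rightarrow> nat) \<Rightarrow> nat \<Rightarrow> (nat list \<Rightarrow> nat) \<Rightarrow> (nat list \<Rightarrow> nat)" where
  "level_config c n \<sigma> = restrict \<sigma> (level c n)"

text \<open>The law \<open>L\<^sup>a(n)\<close> of the configuration at level \<open>n\<close> given that the root has colour \<open>a\<close>.\<close>

definition level_law ::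
    "nat \<Rightarrow> real \<Rightarrow> (nat list \<Rightarrow> nat) \<Rightarrow> nat \<Rightarrow> nat \<Rightarrow> (nat list \<Rightarrow> nat) pmf" where
  "level_law q p c n a =
     map_pmf (level_config c n) (cond_pmf (broadcast q p c n) {\<sigma>. \<sigma> [] = a})"

definition root_posterior ::
    "nat \<Rightarrow> real \<Rightarrow> (nat list \<Rightarrow> nat) \<Rightarrow> nat \<Rightarrow> nat \<Rightarrow> (nat list \<Rightarrow> nat) \<Rightarrow> real" where
  "root_posterior q p c n a L =
     \<P>(\<sigma> in measure_pmf (broadcast q p c n). \<sigma> [] = a \<bar> level_config c n \<sigma> = L)"


section \<open>The moments of \<open>Y\<^sup>+\<close>\<close>

text \<open>
  The tree is drawn first and then the configuration from \<open>L\<^sup>a(n)\<close> on that tree; the posterior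
  is that of an observer who knows the tree.
\<close>

definition broadcast_expectation ::
    "nat \<Rightarrow> real \<Rightarrow> nat pmf \<Rightarrow> nat \<Rightarrow> nat \<Rightarrow>
     ((nat list \<Rightarrow> nat) \<Rightarrow> (nat list \<Rightarrow> nat) \<Rightarrow> real) \<Rightarrow> real" where
  "broadcast_expectation q p d n a f =
     (\<integral>c. measure_pmf.expectation (level_law q p c n a) (f c) \<partial>galton_watson d)"

definition Y_plus ::
    "nat \<Rightarrow> real \<Rightarrow> nat \<Rightarrow> nat \<Rightarrow> (nat list \<Rightarrow> nat) \<Rightarrow> (nat list \<Rightarrow> nat) \<Rightarrow> real" where
  "Y_plus q p n a c L = root_posterior q p c n a L - 1 / real q"

definition x_moment :: "nat \<Rightarrow> real \<Rightarrow> nat pmf \<Rightarrow> nat \<Rightarrow> nat \<Rightarrow> real" where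
  "x_moment q p d a n = broadcast_expectation q p d n a (Y_plus q p n a)"

definition z_moment :: "nat \<Rightarrow> real \<Rightarrow> nat pmf \<Rightarrow> nat \<Rightarrow> nat \<Rightarrow> real" where
  "z_moment q p d a n = broadcast_expectation q p d n a (\<lambda>c L. (Y_plus q p n a c L)\<^sup>2)"

end

theory Submission
  imports Defs "HOL-Combinatorics.Permutations"
begin

text \<open>
  Fix the tree. Write \<open>Y\<^sub>i\<close> for the posterior of colour \<open>i\<close> at a child of the root minus \<open>1/q\<close>, put
  \<open>W\<^sub>i = 1 + \<lambda>qY\<^sub>i\<close>, let \<open>Z\<^sub>i\<close> be the product of the \<open>W\<^sub>i\<close> over all children, and \<open>S = \<Sum>\<^sub>i Z\<^sub>i\<close>. By
  Bayes' rule the posterior of \<open>a\<close> at the root is \<open>Z\<^sub>a/S\<close>. With \<open>R = S - Z\<^sub>a \<ge> 0\<close>, expanding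
  \<open>R/S \<cdot> (1 - S/q)\<^sup>2 \<ge> 0\<close> bounds \<open>Z\<^sub>a/S\<close> by \<open>1 - 2R/q + RS/q\<^sup>2\<close>, whose conditional expectation
  given the root colour \<open>a\<close> is a sum of products over the children. Colour symmetry, \<open>\<Sum>\<^sub>i Y\<^sub>i = 0\<close> and
  Bayes' rule express the factors \<open>E W\<^sub>i\<close> and \<open>E (W\<^sub>iW\<^sub>k)\<close> through the first two moments of \<open>Y\<^sub>a\<close> given \<open>a\<close>
  at that child. Averaging over the tree, the subtrees are independent Galton--Watson trees, so each
  product turns into \<open>E (1 + w)\<^sup>d\<close>, and the binomial theorem gives the stated sum.
\<close>

section \<open>Symmetric families of distributions\<close>

text \<open>The complements of \<open>A\<close> and of its image in \<open>S\<close> have the same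
  size, so any bijection between them completes \<open>f\<close>. Colour symmetry is assumed for
  full permutations only, while the arguments below move two or three named colours.\<close>

lemma permutation_extending:
  assumes S: "finite S" and f: "inj_on f A" "f ` A \<subseteq> S" and A: "A \<subseteq> S"
  obtains \<pi> where "\<pi> permutes S" "\<And>x. x \<in> A \<Longrightarrow> \<pi> x = f x"
proof -
  have "card (S - A) = card (S - f ` A)"
    using assms by (simp add: card_Diff_subset card_image finite_subset)
  then obtain g where g: "bij_betw g (S - A) (S - f ` A)"
    using finite_same_card_bij[of "S - A" "S - f ` A"] S by auto
  define \<pi> where "\<pi> x = (if x \<in> A then f x else if x \<in> S then g x else x)" for x
  have "bij_betw \<pi> A (f ` A)"
    using f(1) by (auto simp: bij_betw_def \<pi>_def inj_on_def)
  moreover have "bij_betw \<pi> (S - A) (S - f ` A)"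
    using g by (subst bij_betw_cong[of _ _ g]) (auto simp: \<pi>_def)
  ultimately have "bij_betw \<pi> (A \<union> (S - A)) (f ` A \<union> (S - f ` A))"
    by (rule bij_betw_combine) auto
  moreover have "A \<union> (S - A) = S" "f ` A \<union> (S - f ` A) = S"
    using A f(2) by auto
  ultimately have "\<pi> permutes S"
    using A by (intro bij_imp_permutes) (auto simp: \<pi>_def)
  then show thesis
    by (rule that) (simp add: \<pi>_def)
qed

lemma sum_split:
  fixes f :: "nat \<Rightarrow> real" and q :: nat
  assumes "b \<in> {1..q}" "\<And>j. j \<in> {1..q} \<Longrightarrow> j \<noteq> b \<Longrightarrow> f j = v"
  shows "(\<Sum>j=1..q. f j) = f b + (real q - 1) * v"
proof -
  have "(\<Sum>j=1..q. f j) = f b + (\<Sum>j\<in>{1..q} - {b}. f j)"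
    using assms(1) by (intro sum.remove) auto
  also have "(\<Sum>j\<in>{1..q} - {b}. f j) = (\<Sum>j\<in>{1..q} - {b}. v)"
    using assms(2) by (intro sum.cong) auto
  finally show ?thesis
    using assms(1) by (simp add: of_nat_diff)
qed

lemma sum_split2:
  fixes f :: "nat \<Rightarrow> real" and q :: nat
  assumes "b \<in> {1..q}" "c \<in> {1..q}" "b \<noteq> c"
    "\<And>j. j \<in> {1..q} \<Longrightarrow> j \<noteq> b \<Longrightarrow> j \<noteq> c \<Longrightarrow> f j = v"
  shows "(\<Sum>j=1..q. f j) = f b + f c + (real q - 2) * v"
proof -
  have "(\<Sum>j=1..q. f j) = f b + (f c + (\<Sum>j\<in>{1..q} - {b} - {c}. f j))"
    using assms(1-3) by (subst sum.remove[of _ b], simp, simp, subst sum.remove[of _ c]) auto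
  also have "(\<Sum>j\<in>{1..q} - {b} - {c}. f j) = (\<Sum>j\<in>{1..q} - {b} - {c}. v)"
    using assms(4) by (intro sum.cong) auto
  finally show ?thesis
    using assms(1-3) by (simp add: of_nat_diff)
qed

text \<open>Bayes' rule with a uniform prior, which cancels. Where no \<open>\<mu> b\<close> with
  \<open>b\<close> a colour charges \<open>l\<close>, division by zero makes the value
  \<open>0\<close>.\<close>

definition posterior :: "nat \<Rightarrow> (nat \<Rightarrow> 'l pmf) \<Rightarrow> nat \<Rightarrow> 'l \<Rightarrow> real" where
  "posterior q \<mu> i l = pmf (\<mu> i) l / (\<Sum>b=1..q. pmf (\<mu> b) l)"

lemma sum_pmf_pos:
  fixes q :: nat
  assumes "b \<in> {1..q}" "l \<in> set_pmf (\<mu> b)"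
  shows "(\<Sum>b=1..q. pmf (\<mu> b) l) > 0"
  using assms by (intro sum_pos2[of "{1..q}" b]) (auto simp: pmf_positive)

lemma sum_posterior:
  assumes "b \<in> {1..q}" "l \<in> set_pmf (\<mu> b)"
  shows "(\<Sum>i=1..q. posterior q \<mu> i l) = 1"
  using sum_pmf_pos[where \<mu> = \<mu> and b = b and l = l, OF assms] unfolding posterior_def by (simp flip: sum_divide_distrib)

lemma posterior_nonneg: "posterior q \<mu> i l \<ge> 0"
  unfolding posterior_def by (intro divide_nonneg_nonneg sum_nonneg) auto

lemma posterior_le_1:
  assumes "i \<in> {1..q}"
  shows "posterior q \<mu> i l \<le> 1"
proof (cases "pmf (\<mu> i) l = 0")
  case False
  then have "l \<in> set_pmf (\<mu> i)" by (simp add: set_pmf_iff)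
  moreover have "pmf (\<mu> i) l \<le> (\<Sum>b=1..q. pmf (\<mu> b) l)"
    using assms by (intro member_le_sum) auto
  ultimately show ?thesis
    using sum_pmf_pos[of i q l \<mu>] assms by (simp add: posterior_def)
qed (simp add: posterior_def)

text \<open>Abstracts the leaf configurations of a fixed tree. A colour permutation acts on
  observations through some \<open>T\<close>, which may depend on \<open>\<pi>\<close> but not on
  \<open>b\<close>; injectivity lets it carry point masses unchanged. Finite supports make every
  function integrable.\<close>

locale symmetric_family =
  fixes q :: nat and \<mu> :: "nat \<Rightarrow> 'l pmf"
  assumes q_ge_3: "3 \<le> q"
    and finite_support: "b \<in> {1..q} \<Longrightarrow> finite (set_pmf (\<mu> b))"
    and symmetric: "\<pi> permutes {1..q} \<Longrightarrow>
      \<exists>T. inj T \<and> (\<forall>b\<in>{1..q}. map_pmf T (\<mu> b) = \<mu> (\<pi> b))"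
begin

abbreviation E :: "nat \<Rightarrow> ('l \<Rightarrow> real) \<Rightarrow> real" where
  "E b f \<equiv> measure_pmf.expectation (\<mu> b) f"

definition Y :: "nat \<Rightarrow> 'l \<Rightarrow> real" where
  "Y i l = posterior q \<mu> i l - 1 / real q"

text \<open>Colour \<open>1\<close> is an arbitrary representative; \<open>E_Y_same\<close> and
  \<open>E_Y_sq_same\<close> remove the choice.\<close>

definition first_moment :: real where "first_moment = E 1 (Y 1)"
definition second_moment :: real where "second_moment = E 1 (\<lambda>l. (Y 1 l)\<^sup>2)"

lemma integrable_E [simp]:
  fixes f :: "'l \<Rightarrow> real"
  shows "b \<in> {1..q} \<Longrightarrow> integrable (measure_pmf (\<mu> b)) f"
  by (intro integrable_measure_pmf_finite finite_support)

lemma E_cong: "(\<And>l. l \<in> set_pmf (\<mu> b) \<Longrightarrow> f l = g l) \<Longrightarrow> E b f = E b g"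
  by (intro integral_cong_AE) (auto simp: AE_measure_pmf_iff)

lemma sum_Y:
  assumes "b \<in> {1..q}" "l \<in> set_pmf (\<mu> b)"
  shows "(\<Sum>i=1..q. Y i l) = 0"
  using sum_posterior[where \<mu> = \<mu> and b = b and l = l, OF assms] q_ge_3 unfolding Y_def by (simp add: sum_subtractf)

text \<open>\<open>T\<close> carries the mass of \<open>\<mu> j\<close> at \<open>l\<close> to that
  of \<open>\<mu> (\<pi> j)\<close> at \<open>T l\<close>. The denominator of the posterior is a sum
  over all colours, hence unchanged, so \<open>T\<close> transports posteriors as well.\<close>

lemma E_permute:
  assumes \<pi>: "\<pi> permutes {1..q}" and b: "b \<in> {1..q}" and i: "i \<in> {1..q}" and k: "k \<in> {1..q}"
  shows "E (\<pi> b) (\<lambda>l. g (Y (\<pi> i) l) (Y (\<pi> k) l)) = E b (\<lambda>l. g (Y i l) (Y k l))"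
proof -
  obtain T where T: "inj T" "\<And>b. b \<in> {1..q} \<Longrightarrow> map_pmf T (\<mu> b) = \<mu> (\<pi> b)"
    using symmetric[OF \<pi>] by blast
  have pmf_T: "pmf (\<mu> (\<pi> j)) (T l) = pmf (\<mu> j) l" if "j \<in> {1..q}" for j l
    using pmf_map_inj'[OF T(1), of "\<mu> j" l] T(2)[OF that] by simp
  have "(\<Sum>b=1..q. pmf (\<mu> b) (T l)) = (\<Sum>b=1..q. pmf (\<mu> b) l)" for l
    by (subst sum.permute[OF \<pi>]) (auto intro!: sum.cong simp: pmf_T)
  then have Y_T: "Y (\<pi> j) (T l) = Y j l" if "j \<in> {1..q}" for j l
    using pmf_T[OF that] by (simp add: Y_def posterior_def)
  show ?thesis
    using i k by (simp add: T(2)[OF b, symmetric] Y_T)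
qed

text \<open>Because \<open>f\<close> extends to a permutation, only the pattern of coincidences
  among the true colour \<open>b\<close> and the two tested colours matters.\<close>

lemma E_relabel:
  assumes f: "inj_on f {b, i, k}" "f ` {b, i, k} \<subseteq> {1..q}" and "{b, i, k} \<subseteq> {1..q}"
  shows "E (f b) (\<lambda>l. g (Y (f i) l) (Y (f k) l)) = E b (\<lambda>l. g (Y i l) (Y k l))"
proof -
  obtain \<pi> where "\<pi> permutes {1..q}" "\<And>x. x \<in> {b, i, k} \<Longrightarrow> \<pi> x = f x"
    using permutation_extending[OF _ f] assms(3) by blast
  then show ?thesis
    using E_permute[of \<pi> b i k g] assms(3) by simp
qed

text \<open>Bayes' rule: both sides equal \<open>\<Sum>l. \<mu> b l * \<mu> i l * f l / (\<Sum>c. \<mu> c l)\<close>.\<close>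

lemma E_posterior_swap:
  assumes "b \<in> {1..q}" "i \<in> {1..q}"
  shows "E b (\<lambda>l. posterior q \<mu> i l * f l) = E i (\<lambda>l. posterior q \<mu> b l * f l)"
proof -
  define S where "S = set_pmf (\<mu> b) \<union> set_pmf (\<mu> i)"
  have S: "finite S"
    using assms finite_support by (simp add: S_def)
  have "E b (\<lambda>l. posterior q \<mu> i l * f l) = (\<Sum>l\<in>S. posterior q \<mu> i l * f l * pmf (\<mu> b) l)"
    by (rule integral_measure_pmf_real[OF S]) (simp add: S_def)
  also have "\<dots> = (\<Sum>l\<in>S. posterior q \<mu> b l * f l * pmf (\<mu> i) l)"
    by (intro sum.cong) (auto simp: posterior_def)
  also have "\<dots> = E i (\<lambda>l. posterior q \<mu> b l * f l)"
    by (rule integral_measure_pmf_real[OF S, symmetric]) (simp add: S_def)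
  finally show ?thesis .
qed

section \<open>Moments of the posterior deviation given the true colour\<close>

lemma E_Y_same:
  assumes "b \<in> {1..q}"
  shows "E b (Y b) = first_moment"
  using E_relabel[of "\<lambda>_. b" 1 1 1 "\<lambda>u _. u"] assms q_ge_3 by (simp add: first_moment_def)

lemma E_Y_sq_same:
  assumes "b \<in> {1..q}"
  shows "E b (\<lambda>l. (Y b l)\<^sup>2) = second_moment"
  using E_relabel[of "\<lambda>_. b" 1 1 1 "\<lambda>u _. u\<^sup>2"] assms q_ge_3 by (simp add: second_moment_def)

text \<open>The deviations sum to \<open>0\<close> on the support, and by symmetry the
  \<open>q - 1\<close> colours other than \<open>b\<close> contribute equally to that sum.\<close>

lemma E_Y_other:
  assumes "b \<in> {1..q}" "i \<in> {1..q}" "b \<noteq> i"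
  shows "E b (Y i) = - first_moment / (real q - 1)"
proof -
  have eq: "E b (Y j) = E b (Y i)" if "j \<in> {1..q}" "j \<noteq> b" for j
    using E_relabel[of "\<lambda>t. if t = i then j else b" b i i "\<lambda>u _. u"] that assms
    by (simp add: inj_on_def)
  have "(\<Sum>j=1..q. E b (Y j)) = E b (\<lambda>l. \<Sum>j=1..q. Y j l)"
    using assms by (subst Bochner_Integration.integral_sum) auto
  also have "\<dots> = E b (\<lambda>_. 0)"
    by (intro E_cong sum_Y[OF assms(1)])
  finally have "E b (Y b) + (real q - 1) * E b (Y i) = 0"
    using sum_split[OF assms(1) eq] by simp
  then show ?thesis
    using assms q_ge_3 by (simp add: E_Y_same field_simps)
qed

lemma E_Y_Y_sum:
  assumes "b \<in> {1..q}"
  shows "(\<Sum>j=1..q. E b (\<lambda>l. Y i l * Y j l)) = 0"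
proof -
  have "(\<Sum>j=1..q. E b (\<lambda>l. Y i l * Y j l)) = E b (\<lambda>l. Y i l * (\<Sum>j=1..q. Y j l))"
    using assms by (simp add: sum_distrib_left)
  also have "\<dots> = E b (\<lambda>_. 0)"
    by (intro E_cong) (simp only: sum_Y[OF assms] mult_zero_right)
  finally show ?thesis by simp
qed

lemma E_Y_same_other:
  assumes "b \<in> {1..q}" "i \<in> {1..q}" "b \<noteq> i"
  shows "E b (\<lambda>l. Y b l * Y i l) = - second_moment / (real q - 1)"
proof -
  have eq: "E b (\<lambda>l. Y b l * Y j l) = E b (\<lambda>l. Y b l * Y i l)" if "j \<in> {1..q}" "j \<noteq> b" for j
    using E_relabel[of "\<lambda>t. if t = i then j else b" b b i "\<lambda>u v. u * v"] that assms
    by (simp add: inj_on_def)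
  have "E b (\<lambda>l. Y b l * Y b l) + (real q - 1) * E b (\<lambda>l. Y b l * Y i l) = 0"
    using sum_split[OF assms(1) eq] E_Y_Y_sum[OF assms(1), of b] by simp
  then show ?thesis
    using E_Y_sq_same[OF assms(1)] q_ge_3 by (simp add: field_simps power2_eq_square)
qed

text \<open>The zero sum gives only one relation between this moment and the mixed one in
  \<open>E_Y_other_other\<close>. The second relation is \<open>E_posterior_swap\<close>: exchanging
  the true colour \<open>b\<close> with \<open>i\<close> leads to the known
  \<open>E i (\<lambda>l. Y i l * Y b l)\<close>, and writing the posterior as \<open>Y\<close> plus
  \<open>1 / q\<close> yields a linear equation.\<close>

lemma E_Y_sq_other:
  assumes "b \<in> {1..q}" "i \<in> {1..q}" "b \<noteq> i"
  shows "E b (\<lambda>l. (Y i l)\<^sup>2) = (first_moment - second_moment) / (real q - 1)"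
proof -
  have "E b (\<lambda>l. posterior q \<mu> i l * Y i l) = E i (\<lambda>l. posterior q \<mu> b l * Y i l)"
    by (intro E_posterior_swap assms)
  moreover have "posterior q \<mu> j l * Y i l = Y i l * Y j l + Y i l / real q" for j l
    using q_ge_3 by (simp add: Y_def divide_simps) (simp add: algebra_simps)
  ultimately have "E b (\<lambda>l. Y i l * Y i l + Y i l / real q) = E i (\<lambda>l. Y i l * Y b l + Y i l / real q)"
    by simp
  then have "E b (\<lambda>l. (Y i l)\<^sup>2) + E b (Y i) / real q = E i (\<lambda>l. Y i l * Y b l) + E i (Y i) / real q"
    using assms by (simp add: power2_eq_square)
  \<comment> \<open>Multiplied through by \<open>q * (q - 1)\<close>, with a factor \<open>q\<close>
    left on every term to be cancelled next.\<close>
  then have "real q * second_moment + real q * (real q * E b (\<lambda>l. (Y i l)\<^sup>2)) =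
      real q * first_moment + real q * E b (\<lambda>l. (Y i l)\<^sup>2)"
    using assms q_ge_3
    by (simp add: E_Y_same E_Y_other E_Y_same_other) (simp add: field_simps)
  then have "second_moment + real q * E b (\<lambda>l. (Y i l)\<^sup>2) =
      first_moment + E b (\<lambda>l. (Y i l)\<^sup>2)"
    unfolding distrib_left[symmetric] mult_cancel_left using q_ge_3 by simp
  then show ?thesis
    using q_ge_3 by (simp add: field_simps)
qed

text \<open>In the vanishing sum of \<open>E b (\<lambda>l. Y i l * Y j l)\<close> over
  \<open>j\<close>, the terms \<open>j = b\<close> and \<open>j = i\<close> are known and the other
  \<open>q - 2\<close> are equal by \<open>E_relabel\<close>.\<close>

lemma E_Y_other_other:
  assumes "b \<in> {1..q}" "i \<in> {1..q}" "k \<in> {1..q}" "b \<noteq> i" "b \<noteq> k" "i \<noteq> k"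
  shows "E b (\<lambda>l. Y i l * Y k l) =
    (2 * second_moment - first_moment) / ((real q - 1) * (real q - 2))"
proof -
  have eq: "E b (\<lambda>l. Y i l * Y j l) = E b (\<lambda>l. Y i l * Y k l)"
    if "j \<in> {1..q}" "j \<noteq> b" "j \<noteq> i" for j
    using E_relabel[of "\<lambda>t. if t = k then j else t" b i k "\<lambda>u v. u * v"] that assms
    by (auto simp: inj_on_def)
  have "E b (\<lambda>l. Y i l * Y b l) + E b (\<lambda>l. Y i l * Y i l) + (real q - 2) * E b (\<lambda>l. Y i l * Y k l) = 0"
    using sum_split2[OF assms(1,2,4) eq] E_Y_Y_sum[OF assms(1), of i] by simp
  moreover have "E b (\<lambda>l. Y i l * Y b l) = - second_moment / (real q - 1)"
    using E_Y_same_other[OF assms(1,2,4)] by (simp add: mult.commute)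
  moreover have "E b (\<lambda>l. Y i l * Y i l) = (first_moment - second_moment) / (real q - 1)"
    using E_Y_sq_other[OF assms(1,2,4)] by (simp add: power2_eq_square)
  ultimately have "(real q - 2) * E b (\<lambda>l. Y i l * Y k l) =
      (2 * second_moment - first_moment) / (real q - 1)"
    by (simp add: diff_divide_distrib)
  moreover have "real q - 2 > 0"
    using q_ge_3 by simp
  ultimately show ?thesis
    by (simp add: eq_divide_eq ac_simps)
qed

end

section \<open>Mixtures along the Potts channel\<close>

text \<open>The law of what is observed below a child when the parent has colour \<open>a\<close>:
  the channel picks the child's colour.\<close>

definition mixture :: "nat \<Rightarrow> real \<Rightarrow> (nat \<Rightarrow> 'l pmf) \<Rightarrow> nat \<Rightarrow> 'l pmf" where
  "mixture q p \<mu> a = bind_pmf (potts_row q p a) \<mu>"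

text \<open>The density of \<open>mixture q p \<mu> i\<close> relative to the average of the
  \<open>\<mu> b\<close> over the colours, which is also the average of the mixtures. This
  normalisation does not depend on \<open>i\<close>, so it cancels in posteriors, and it makes the
  ratio affine in \<open>Y\<close>, as \<open>W_eq\<close> shows.\<close>

definition likelihood_ratio :: "nat \<Rightarrow> real \<Rightarrow> (nat \<Rightarrow> 'l pmf) \<Rightarrow> nat \<Rightarrow> 'l \<Rightarrow> real" where
  "likelihood_ratio q p \<mu> i l = real q * pmf (mixture q p \<mu> i) l / (\<Sum>b=1..q. pmf (\<mu> b) l)"

locale potts =
  fixes q :: nat and p :: real
  assumes q3: "3 \<le> q" and p0: "0 \<le> p" and p1: "p \<le> 1"
begin

definition lam :: real where "lam = 1 - p * real q / (real q - 1)"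

lemma set_potts_row: "a \<in> {1..q} \<Longrightarrow> set_pmf (potts_row q p a) \<subseteq> {1..q}"
  using q3 p0 p1 by (auto simp: set_pmf_iff pmf_potts_row split: if_splits)

lemma pmf_potts_row':
  assumes "a \<in> {1..q}" "b \<in> {1..q}"
  shows "pmf (potts_row q p a) b = (if a = b then 1 - p else p / (real q - 1))"
  using assms q3 p0 p1 by (simp add: pmf_potts_row potts_matrix_def)

text \<open>The channel matrix is \<open>lam\<close> times the identity plus the constant matrix
  with entries \<open>(1 - lam) / q\<close>, which equals \<open>p / (q - 1)\<close>.\<close>

lemma sum_potts_row:
  assumes "a \<in> {1..q}"
  shows "(\<Sum>b=1..q. pmf (potts_row q p a) b * f b) =
    lam * f a + (1 - lam) / real q * (\<Sum>b=1..q. f b)"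
proof -
  have "(\<Sum>b=1..q. pmf (potts_row q p a) b * f b) =
      (\<Sum>b=1..q. (if a = b then lam * f b else 0) + (1 - lam) / real q * f b)"
  proof (intro sum.cong refl)
    fix b assume "b \<in> {1..q}"
    then have "pmf (potts_row q p a) b = (if a = b then lam else 0) + (1 - lam) / real q"
      using assms q3 by (simp add: pmf_potts_row' lam_def field_simps)
    then show "pmf (potts_row q p a) b * f b =
        (if a = b then lam * f b else 0) + (1 - lam) / real q * f b"
      by (simp add: algebra_simps)
  qed
  also have "\<dots> = lam * f a + (1 - lam) / real q * (\<Sum>b=1..q. f b)"
    using assms by (simp add: sum.distrib sum_distrib_left)
  finally show ?thesis .
qed

lemma set_mixture:
  assumes "a \<in> {1..q}" "l \<in> set_pmf (mixture q p \<mu> a)"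
  obtains b where "b \<in> {1..q}" "l \<in> set_pmf (\<mu> b)"
  using assms set_potts_row[of a] by (auto simp: mixture_def)

lemma pmf_mixture:
  assumes "a \<in> {1..q}"
  shows "pmf (mixture q p \<mu> a) l = lam * pmf (\<mu> a) l + (1 - lam) / real q * (\<Sum>b=1..q. pmf (\<mu> b) l)"
proof -
  have "pmf (mixture q p \<mu> a) l = (\<Sum>b=1..q. pmf (\<mu> b) l * pmf (potts_row q p a) b)"
    unfolding mixture_def pmf_bind
    by (rule integral_measure_pmf_real) (use set_potts_row[OF assms] in auto)
  also have "\<dots> = (\<Sum>b=1..q. pmf (potts_row q p a) b * pmf (\<mu> b) l)"
    by (simp add: mult.commute)
  finally show ?thesis
    by (simp only: sum_potts_row[OF assms])
qed

lemma finite_mixture: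
  assumes "a \<in> {1..q}" "\<And>b. b \<in> {1..q} \<Longrightarrow> finite (set_pmf (\<mu> b))"
  shows "finite (set_pmf (mixture q p \<mu> a))"
proof -
  have "set_pmf (mixture q p \<mu> a) \<subseteq> (\<Union>b\<in>{1..q}. set_pmf (\<mu> b))"
    using set_potts_row[OF assms(1)] by (auto simp: mixture_def)
  then show ?thesis
    by (rule finite_subset) (use assms(2) in auto)
qed

lemma likelihood_ratio_nonneg: "likelihood_ratio q p \<mu> i l \<ge> 0"
  by (auto simp: likelihood_ratio_def intro!: divide_nonneg_nonneg sum_nonneg)

end

locale potts_family = potts q p + symmetric_family q \<mu>
  for q :: nat and p :: real and \<mu> :: "nat \<Rightarrow> 'l pmf"
begin

section \<open>Moments of the likelihood ratios given the parent's colour\<close>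

abbreviation E' :: "nat \<Rightarrow> ('l \<Rightarrow> real) \<Rightarrow> real" where
  "E' a f \<equiv> measure_pmf.expectation (mixture q p \<mu> a) f"

abbreviation W :: "nat \<Rightarrow> 'l \<Rightarrow> real" where
  "W i l \<equiv> likelihood_ratio q p \<mu> i l"

lemma integrable_E' [simp]:
  fixes f :: "'l \<Rightarrow> real"
  shows "a \<in> {1..q} \<Longrightarrow> integrable (measure_pmf (mixture q p \<mu> a)) f"
  by (intro integrable_measure_pmf_finite finite_mixture finite_support)

lemma E'_eq:
  assumes "a \<in> {1..q}"
  shows "E' a f = lam * E a f + (1 - lam) / real q * (\<Sum>b=1..q. E b f)"
proof -
  have "E' a f = (\<Sum>b=1..q. pmf (potts_row q p a) b *\<^sub>R E b f)"
    unfolding mixture_def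
    by (intro pmf_expectation_bind finite_support set_potts_row assms) auto
  then show ?thesis
    by (simp only: sum_potts_row[OF assms] real_scaleR_def)
qed

text \<open>Divide \<open>pmf_mixture\<close> by the sum of the masses over the colours. On the
  support that sum is positive; where it vanishes, the left side is \<open>0\<close> and the right
  side \<open>1 - lam\<close>.\<close>

lemma W_eq:
  assumes "a \<in> {1..q}" "i \<in> {1..q}" "l \<in> set_pmf (mixture q p \<mu> a)"
  shows "W i l = 1 + lam * real q * Y i l"
proof -
  obtain b where "b \<in> {1..q}" "l \<in> set_pmf (\<mu> b)"
    using set_mixture[OF assms(1,3)] .
  then have "(\<Sum>b=1..q. pmf (\<mu> b) l) > 0"
    by (rule sum_pmf_pos)
  then show ?thesis
    using q3 by (simp add: likelihood_ratio_def pmf_mixture[OF assms(2)] Y_def posterior_def field_simps)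
qed

lemma E'_W:
  assumes "a \<in> {1..q}" "i \<in> {1..q}"
  shows "E' a (W i) = 1 + lam * real q * E' a (Y i)"
proof -
  have "E' a (W i) = E' a (\<lambda>l. 1 + lam * real q * Y i l)"
    by (intro integral_cong_AE) (auto simp: AE_measure_pmf_iff W_eq[OF assms])
  then show ?thesis
    using assms by simp
qed

lemma E'_W_W:
  assumes "a \<in> {1..q}" "i \<in> {1..q}" "k \<in> {1..q}"
  shows "E' a (\<lambda>l. W i l * W k l) =
    1 + lam * real q * (E' a (Y i) + E' a (Y k)) + (lam * real q)\<^sup>2 * E' a (\<lambda>l. Y i l * Y k l)"
proof -
  have "E' a (\<lambda>l. W i l * W k l) =
      E' a (\<lambda>l. 1 + lam * real q * (Y i l + Y k l) + (lam * real q)\<^sup>2 * (Y i l * Y k l))"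
    using assms
    by (intro integral_cong_AE)
       (auto simp: AE_measure_pmf_iff W_eq algebra_simps power2_eq_square)
  then show ?thesis
    using assms by (simp add: distrib_left)
qed

text \<open>Summed over the true colour \<open>b\<close>, the expectations of \<open>Y i\<close>
  cancel, so the uniform part of the channel contributes nothing and the edge only scales by
  \<open>lam\<close>.\<close>

lemma E'_Y:
  assumes "a \<in> {1..q}" "i \<in> {1..q}"
  shows "E' a (Y i) = (if a = i then lam * first_moment else - lam * first_moment / (real q - 1))"
proof -
  have "(\<Sum>b=1..q. E b (Y i)) = E i (Y i) + (real q - 1) * (- first_moment / (real q - 1))"
    by (intro sum_split assms(2) E_Y_other) (use assms in auto)
  then have "(\<Sum>b=1..q. E b (Y i)) = 0"
    using q3 assms by (simp add: E_Y_same)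
  then show ?thesis
    using assms by (simp add: E'_eq E_Y_same E_Y_other)
qed

text \<open>Here the uniform part of the channel survives: summed over the true colour, the second
  moments of \<open>Y i\<close> give \<open>first_moment\<close>.\<close>

lemma E'_Y_sq_other:
  assumes "a \<in> {1..q}" "i \<in> {1..q}" "a \<noteq> i"
  shows "E' a (\<lambda>l. Y i l * Y i l) =
    (real q - 1 + lam) * first_moment / (real q * (real q - 1)) - lam * second_moment / (real q - 1)"
proof -
  have "(\<Sum>b=1..q. E b (\<lambda>l. Y i l * Y i l)) =
      E i (\<lambda>l. Y i l * Y i l) + (real q - 1) * ((first_moment - second_moment) / (real q - 1))"
    by (intro sum_split assms(2)) (use assms E_Y_sq_other in \<open>auto simp: power2_eq_square\<close>)
  then have "(\<Sum>b=1..q. E b (\<lambda>l. Y i l * Y i l)) = first_moment"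
    using q3 E_Y_sq_same[OF assms(2)] by (simp add: power2_eq_square)
  then have "E' a (\<lambda>l. Y i l * Y i l) =
      lam * ((first_moment - second_moment) / (real q - 1)) + (1 - lam) / real q * first_moment"
    using E_Y_sq_other[OF assms] assms by (simp add: E'_eq power2_eq_square)
  then show ?thesis
    using q3 by (simp add: divide_simps) (simp add: algebra_simps)
qed

lemma E'_Y_same_other:
  assumes "a \<in> {1..q}" "i \<in> {1..q}" "a \<noteq> i"
  shows "E' a (\<lambda>l. Y a l * Y i l) =
    (real q - 1 + lam) * first_moment / (real q * (real q - 1)) - lam * second_moment / (real q - 1)
      - first_moment / (real q - 1)"
proof -
  have "(\<Sum>b=1..q. E b (\<lambda>l. Y a l * Y i l)) =
      E a (\<lambda>l. Y a l * Y i l) + E i (\<lambda>l. Y a l * Y i l) +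
      (real q - 2) * ((2 * second_moment - first_moment) / ((real q - 1) * (real q - 2)))"
    by (intro sum_split2 assms E_Y_other_other) (use assms in auto)
  also have "E i (\<lambda>l. Y a l * Y i l) = - second_moment / (real q - 1)"
    using E_Y_same_other[of i a] assms by (simp add: mult.commute)
  also have "E a (\<lambda>l. Y a l * Y i l) = - second_moment / (real q - 1)"
    by (intro E_Y_same_other assms)
  finally have "(\<Sum>b=1..q. E b (\<lambda>l. Y a l * Y i l)) = - first_moment / (real q - 1)"
    using q3 by (simp add: divide_simps)
  then have "E' a (\<lambda>l. Y a l * Y i l) =
      lam * (- second_moment / (real q - 1)) + (1 - lam) / real q * (- first_moment / (real q - 1))"
    using assms by (simp add: E'_eq E_Y_same_other)
  then show ?thesis
    using q3 by (simp add: divide_simps) (simp add: algebra_simps)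
qed

lemma E'_Y_other_other:
  assumes "a \<in> {1..q}" "i \<in> {1..q}" "k \<in> {1..q}" "a \<noteq> i" "a \<noteq> k" "i \<noteq> k"
  shows "E' a (\<lambda>l. Y i l * Y k l) =
    (2 * lam * second_moment - (real q - 2 + 2 * lam) * first_moment / real q)
      / ((real q - 1) * (real q - 2))"
proof -
  have "(\<Sum>b=1..q. E b (\<lambda>l. Y i l * Y k l)) =
      E i (\<lambda>l. Y i l * Y k l) + E k (\<lambda>l. Y i l * Y k l) +
      (real q - 2) * ((2 * second_moment - first_moment) / ((real q - 1) * (real q - 2)))"
    by (intro sum_split2 assms E_Y_other_other) (use assms in auto)
  also have "E k (\<lambda>l. Y i l * Y k l) = - second_moment / (real q - 1)"
    using E_Y_same_other[of k i] assms by (simp add: mult.commute)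
  also have "E i (\<lambda>l. Y i l * Y k l) = - second_moment / (real q - 1)"
    by (intro E_Y_same_other assms)
  finally have "(\<Sum>b=1..q. E b (\<lambda>l. Y i l * Y k l)) = - first_moment / (real q - 1)"
    using q3 by (simp add: divide_simps)
  then have "E' a (\<lambda>l. Y i l * Y k l) =
      lam * ((2 * second_moment - first_moment) / ((real q - 1) * (real q - 2)))
      + (1 - lam) / real q * (- first_moment / (real q - 1))"
    using assms by (simp add: E'_eq E_Y_other_other)
  then show ?thesis
    using q3 by (simp add: divide_simps) (simp add: algebra_simps)
qed

lemma E'_W_other:
  assumes "a \<in> {1..q}" "i \<in> {1..q}" "a \<noteq> i"
  shows "E' a (W i) = 1 + lam\<^sup>2 * (- (real q / (real q - 1)) * first_moment)"
  using assms by (simp add: E'_W E'_Y power2_eq_square)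

lemma E'_W_sq_other:
  assumes "a \<in> {1..q}" "i \<in> {1..q}" "a \<noteq> i"
  shows "E' a (\<lambda>l. W i l * W i l) = 1 + lam\<^sup>2 *
    (real q * (real q - 3 + lam) / (real q - 1) * first_moment
     - (real q)\<^sup>2 * lam / (real q - 1) * second_moment)"
  using assms q3
  by (simp add: E'_W_W E'_Y E'_Y_sq_other)
     (simp add: divide_simps, simp add: algebra_simps power2_eq_square)

text \<open>The value coincides with that in \<open>E'_W_sq_other\<close>: as \<open>W a\<close> is
  the density of \<open>mixture q p \<mu> a\<close>, both are averages of a product of three ratios
  in which \<open>i\<close> or \<open>a\<close> occurs twice, and swapping these colours exchanges
  them. The proof computes from the moments of \<open>Y\<close> instead.\<close>

lemma E'_W_same_other:
  assumes "a \<in> {1..q}" "i \<in> {1..q}" "a \<noteq> i"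
  shows "E' a (\<lambda>l. W i l * W a l) = 1 + lam\<^sup>2 *
    (real q * (real q - 3 + lam) / (real q - 1) * first_moment
     - (real q)\<^sup>2 * lam / (real q - 1) * second_moment)"
proof -
  have "E' a (\<lambda>l. W i l * W a l) = E' a (\<lambda>l. W a l * W i l)"
    by (simp add: mult.commute)
  also have "\<dots> = 1 + lam\<^sup>2 *
    (real q * (real q - 3 + lam) / (real q - 1) * first_moment
     - (real q)\<^sup>2 * lam / (real q - 1) * second_moment)"
    using assms q3
    by (simp add: E'_W_W E'_Y E'_Y_same_other)
       (simp add: divide_simps, simp add: algebra_simps power2_eq_square)
  finally show ?thesis .
qed

lemma E'_W_other_other:
  assumes "a \<in> {1..q}" "i \<in> {1..q}" "k \<in> {1..q}" "a \<noteq> i" "a \<noteq> k" "i \<noteq> k"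
  shows "E' a (\<lambda>l. W i l * W k l) = 1 + lam\<^sup>2 *
    (- (real q * (3 * real q - 6 + 2 * lam) / ((real q - 1) * (real q - 2))) * first_moment
     + 2 * (real q)\<^sup>2 * lam / ((real q - 1) * (real q - 2)) * second_moment)"
  using assms q3
  by (simp add: E'_W_W E'_Y E'_Y_other_other)
     (simp add: divide_simps, simp add: algebra_simps power2_eq_square)

end

section \<open>Combining independent observations\<close>

context potts
begin

text \<open>\<open>square_coeff\<close>, \<open>cross_coeff\<close> and \<open>mean_coeff\<close>
  are the excess over \<open>1\<close>, with a factor \<open>lam\<^sup>2\<close> taken out, of the
  expectations of \<open>W i * W i\<close> (equally \<open>W i * W a\<close>),
  \<open>W i * W k\<close> and \<open>W i\<close>, for distinct \<open>i\<close> and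
  \<open>k\<close> other than the parent's colour \<open>a\<close>. They are the bases of the powers
  in the theorem. Being linear in the moments, they commute with averaging over trees.\<close>

definition square_coeff :: "real \<Rightarrow> real \<Rightarrow> real" where
  "square_coeff x z = real q * (real q - 3 + lam) / (real q - 1) * x - (real q)\<^sup>2 * lam / (real q - 1) * z"

definition cross_coeff :: "real \<Rightarrow> real \<Rightarrow> real" where
  "cross_coeff x z = - (real q * (3 * real q - 6 + 2 * lam) / ((real q - 1) * (real q - 2))) * x
     + 2 * (real q)\<^sup>2 * lam / ((real q - 1) * (real q - 2)) * z"

definition mean_coeff :: "real \<Rightarrow> real" where
  "mean_coeff x = - (real q / (real q - 1)) * x"

text \<open>The bound is a polynomial in \<open>S\<close> and \<open>Z\<close>, so its expectation
  is a combination of products over the children, unlike that of the quotient. Equality holds at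
  \<open>S = q\<close>, the value of the sum when there is at most one child.\<close>

lemma ratio_bound:
  fixes S Z :: real
  assumes "0 \<le> Z" "Z \<le> S" "0 < S"
  shows "Z / S - 1 / real q \<le>
    (real q - 1) / real q + (1 / real q)\<^sup>2 * ((S - Z) * S) - 2 / real q * (S - Z)"
proof -
  have "0 \<le> (S - Z) / S * (1 - S / real q)\<^sup>2"
    using assms by simp
  also have "\<dots> = 1 - Z / S + (1 / real q)\<^sup>2 * ((S - Z) * S) - 2 / real q * (S - Z)"
    using assms q3 by (simp add: divide_simps power2_eq_square) (simp add: algebra_simps)
  finally show ?thesis
    using q3 by (simp add: diff_divide_distrib)
qed

text \<open>The product of the ratios is the joint mass of the observations times \<open>K\<close>,
  which does not depend on the colour and cancels. \<open>g\<close> only re-encodes the tuple of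
  observations and, being injective, preserves point masses. For \<open>F\<close> in the support,
  \<open>K\<close> is positive.\<close>

lemma combined_posterior:
  fixes \<mu> :: "nat \<Rightarrow> nat \<Rightarrow> 'l pmf" and g :: "(nat \<Rightarrow> 'l) \<Rightarrow> 'k"
  assumes g: "inj g"
    and \<nu>: "\<And>b. b \<in> {1..q} \<Longrightarrow> \<nu> b = map_pmf g (Pi_pmf {..<m} dflt (\<lambda>j. mixture q p (\<mu> j) b))"
    and a: "a \<in> {1..q}" and F: "F \<in> set_pmf (Pi_pmf {..<m} dflt (\<lambda>j. mixture q p (\<mu> j) a))"
  defines "Z \<equiv> \<lambda>i. \<Prod>j<m. likelihood_ratio q p (\<mu> j) i (F j)"
  shows "posterior q \<nu> a (g F) = Z a / (\<Sum>i=1..q. Z i)" "(\<Sum>i=1..q. Z i) > 0"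
proof -
  define K where "K = (\<Prod>j<m. real q / (\<Sum>b=1..q. pmf (\<mu> j b) (F j)))"
  have F_dflt: "F j = dflt" if "j \<notin> {..<m}" for j
    using F set_Pi_pmf_subset[of "{..<m}" dflt] that by blast
  have F_mem: "F j \<in> set_pmf (mixture q p (\<mu> j) a)" if "j < m" for j
    using F that by (auto simp: set_Pi_pmf PiE_dflt_def)
  have "(\<Sum>b=1..q. pmf (\<mu> j b) (F j)) > 0" if j: "j < m" for j
  proof -
    obtain b where "b \<in> {1..q}" "F j \<in> set_pmf (\<mu> j b)"
      using set_mixture[OF a F_mem[OF j]] .
    then show ?thesis by (rule sum_pmf_pos)
  qed
  then have K: "K > 0"
    unfolding K_def using q3 by (intro prod_pos divide_pos_pos) auto
  have Z: "Z i = K * pmf (\<nu> i) (g F)" if "i \<in> {1..q}" for i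
  proof -
    have "pmf (\<nu> i) (g F) = (\<Prod>j<m. pmf (mixture q p (\<mu> j) i) (F j))"
      using that by (simp add: \<nu> pmf_map_inj'[OF g]) (rule pmf_Pi', use F_dflt in auto)
    then show ?thesis
      by (simp add: Z_def K_def likelihood_ratio_def flip: prod.distrib)
  qed
  have sum_Z: "(\<Sum>i=1..q. Z i) = K * (\<Sum>i=1..q. pmf (\<nu> i) (g F))"
    by (simp add: Z sum_distrib_left)
  show "posterior q \<nu> a (g F) = Z a / (\<Sum>i=1..q. Z i)"
    using K unfolding sum_Z Z[OF a] posterior_def by simp
  have "g F \<in> set_pmf (\<nu> a)"
    using F a by (simp add: \<nu>)
  then show "(\<Sum>i=1..q. Z i) > 0"
    using sum_pmf_pos[OF a, where \<mu> = \<nu> and l = "g F"] K unfolding sum_Z by simp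
qed

text \<open>Integrate \<open>ratio_bound\<close>; by independence every product of ratios has a
  product expectation. The moments \<open>x j\<close> and \<open>z j\<close> may differ from child
  to child, since the subtrees of a fixed tree differ.\<close>

lemma combined_first_moment_le:
  fixes \<mu> :: "nat \<Rightarrow> nat \<Rightarrow> 'l pmf" and g :: "(nat \<Rightarrow> 'l) \<Rightarrow> 'k"
  assumes fam: "\<And>j. j < m \<Longrightarrow> symmetric_family q (\<mu> j)"
    and g: "inj g"
    and \<nu>: "\<And>b. b \<in> {1..q} \<Longrightarrow> \<nu> b = map_pmf g (Pi_pmf {..<m} dflt (\<lambda>j. mixture q p (\<mu> j) b))"
    and a: "a \<in> {1..q}"
  defines "x \<equiv> \<lambda>j. symmetric_family.first_moment q (\<mu> j)"
    and "z \<equiv> \<lambda>j. symmetric_family.second_moment q (\<mu> j)"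
  shows "measure_pmf.expectation (\<nu> a) (\<lambda>l. posterior q \<nu> a l - 1 / real q) \<le>
    (real q - 1) / real q + (real q - 1) / (real q)\<^sup>2 *
      (2 * (\<Prod>j<m. 1 + lam\<^sup>2 * square_coeff (x j) (z j))
       + (real q - 2) * (\<Prod>j<m. 1 + lam\<^sup>2 * cross_coeff (x j) (z j))
       - 2 * real q * (\<Prod>j<m. 1 + lam\<^sup>2 * mean_coeff (x j)))"
proof -
  define Q where "Q = Pi_pmf {..<m} dflt (\<lambda>j. mixture q p (\<mu> j) a)"
  define Z where "Z i F = (\<Prod>j<m. likelihood_ratio q p (\<mu> j) i (F j))" for i F
  define S where "S F = (\<Sum>i=1..q. Z i F)" for F
  let ?E = "measure_pmf.expectation Q"
  let ?I = "{1..q} - {a}"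
  have pfam: "potts_family q p (\<mu> j)" if "j < m" for j
    using fam[OF that] by (intro potts_family.intro potts_axioms)
  have fin_mix: "finite (set_pmf (mixture q p (\<mu> j) a))" if "j < m" for j
    using fam[OF that] a by (intro finite_mixture symmetric_family.finite_support)
  have "finite (set_pmf Q)"
    unfolding Q_def by (subst set_Pi_pmf) (auto intro!: finite_PiE_dflt fin_mix)
  then have int [simp]: "integrable (measure_pmf Q) f" for f :: "_ \<Rightarrow> real"
    by (rule integrable_measure_pmf_finite)
  have Z_nonneg: "Z i F \<ge> 0" for i F
    unfolding Z_def by (intro prod_nonneg likelihood_ratio_nonneg ballI)
  have R: "S F - Z a F = (\<Sum>i\<in>?I. Z i F)" for F
    unfolding S_def using a by (subst sum.remove[of _ a]) auto
  have E_Z: "?E (Z i) = (\<Prod>j<m. 1 + lam\<^sup>2 * mean_coeff (x j))" if "i \<in> ?I" for i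
  proof -
    have "?E (Z i) = (\<Prod>j<m. measure_pmf.expectation (mixture q p (\<mu> j) a)
        (likelihood_ratio q p (\<mu> j) i))"
      unfolding Q_def Z_def
      by (intro expectation_prod_Pi_pmf integrable_measure_pmf_finite fin_mix likelihood_ratio_nonneg) auto
    also have "\<dots> = (\<Prod>j<m. 1 + lam\<^sup>2 * mean_coeff (x j))"
      using that a
      by (intro prod.cong) (auto simp: potts_family.E'_W_other[OF pfam] mean_coeff_def x_def)
    finally show ?thesis .
  qed
  have E_ZZ: "?E (\<lambda>F. Z i F * Z k F) = (\<Prod>j<m. measure_pmf.expectation (mixture q p (\<mu> j) a)
        (\<lambda>l. likelihood_ratio q p (\<mu> j) i l * likelihood_ratio q p (\<mu> j) k l))" for i k
    unfolding Q_def Z_def prod.distrib[symmetric]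
    by (intro expectation_prod_Pi_pmf integrable_measure_pmf_finite fin_mix
          likelihood_ratio_nonneg mult_nonneg_nonneg) auto
  have E_ZZ_square: "?E (\<lambda>F. Z i F * Z k F) = (\<Prod>j<m. 1 + lam\<^sup>2 * square_coeff (x j) (z j))"
    if "i \<in> ?I" "k = i \<or> k = a" for i k
    unfolding E_ZZ using that a
    by (intro prod.cong) (auto simp: potts_family.E'_W_sq_other[OF pfam]
      potts_family.E'_W_same_other[OF pfam] square_coeff_def x_def z_def)
  have E_ZZ_cross: "?E (\<lambda>F. Z i F * Z k F) = (\<Prod>j<m. 1 + lam\<^sup>2 * cross_coeff (x j) (z j))"
    if "i \<in> ?I" "k \<in> ?I" "k \<noteq> i" for i k
    unfolding E_ZZ using that a
    by (intro prod.cong) (auto simp: potts_family.E'_W_other_other[OF pfam]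
      cross_coeff_def x_def z_def)
  have E_R: "?E (\<lambda>F. S F - Z a F) = (real q - 1) * (\<Prod>j<m. 1 + lam\<^sup>2 * mean_coeff (x j))"
    unfolding R using a by (simp add: E_Z of_nat_diff)
  have E_RS: "?E (\<lambda>F. (S F - Z a F) * S F) = (real q - 1) *
      (2 * (\<Prod>j<m. 1 + lam\<^sup>2 * square_coeff (x j) (z j))
       + (real q - 2) * (\<Prod>j<m. 1 + lam\<^sup>2 * cross_coeff (x j) (z j)))"
  proof -
    have "?E (\<lambda>F. (S F - Z a F) * S F) = (\<Sum>i\<in>?I. \<Sum>k=1..q. ?E (\<lambda>F. Z i F * Z k F))"
      unfolding R unfolding S_def by (simp add: sum_product)
    also have "\<dots> = (\<Sum>i\<in>?I. 2 * (\<Prod>j<m. 1 + lam\<^sup>2 * square_coeff (x j) (z j))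
       + (real q - 2) * (\<Prod>j<m. 1 + lam\<^sup>2 * cross_coeff (x j) (z j)))"
    proof (intro sum.cong refl)
      \<comment> \<open>For fixed \<open>i\<close>, the terms \<open>k = i\<close> and
        \<open>k = a\<close> have the same expectation, hence the factor \<open>2\<close>; the other
        \<open>q - 2\<close> values of \<open>k\<close> give cross terms.\<close>
      fix i assume i: "i \<in> ?I"
      have "(\<Sum>k=1..q. ?E (\<lambda>F. Z i F * Z k F)) =
          ?E (\<lambda>F. Z i F * Z i F) + ?E (\<lambda>F. Z i F * Z a F)
          + (real q - 2) * (\<Prod>j<m. 1 + lam\<^sup>2 * cross_coeff (x j) (z j))"
        using i a by (intro sum_split2 E_ZZ_cross) auto
      then show "(\<Sum>k=1..q. ?E (\<lambda>F. Z i F * Z k F)) =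
          2 * (\<Prod>j<m. 1 + lam\<^sup>2 * square_coeff (x j) (z j))
          + (real q - 2) * (\<Prod>j<m. 1 + lam\<^sup>2 * cross_coeff (x j) (z j))"
        using E_ZZ_square[OF i] by simp
    qed
    finally show ?thesis
      using a by (simp add: of_nat_diff)
  qed
  have "measure_pmf.expectation (\<nu> a) (\<lambda>l. posterior q \<nu> a l - 1 / real q) =
      ?E (\<lambda>F. posterior q \<nu> a (g F) - 1 / real q)"
    using a by (simp add: \<nu> Q_def)
  also have "\<dots> \<le> ?E (\<lambda>F. (real q - 1) / real q + (1 / real q)\<^sup>2 * ((S F - Z a F) * S F)
      - 2 / real q * (S F - Z a F))"
  proof (intro integral_mono_AE int, rule AE_pmfI)
    fix F assume "F \<in> set_pmf Q"
    then have F: "F \<in> set_pmf (Pi_pmf {..<m} dflt (\<lambda>j. mixture q p (\<mu> j) a))"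
      by (simp add: Q_def)
    have "posterior q \<nu> a (g F) = Z a F / S F" "S F > 0"
      using combined_posterior[OF g \<nu> a F] by (simp_all add: Z_def S_def)
    moreover have "Z a F \<le> S F"
      using R[of F] by (metis Z_nonneg diff_ge_0_iff_ge sum_nonneg)
    ultimately show "posterior q \<nu> a (g F) - 1 / real q \<le> (real q - 1) / real q
        + (1 / real q)\<^sup>2 * ((S F - Z a F) * S F) - 2 / real q * (S F - Z a F)"
      using ratio_bound[OF Z_nonneg] by metis
  qed
  also have "\<dots> = (real q - 1) / real q + (1 / real q)\<^sup>2 * ?E (\<lambda>F. (S F - Z a F) * S F)
      - 2 / real q * ?E (\<lambda>F. S F - Z a F)"
    by simp
  also have "\<dots> = (real q - 1) / real q + (real q - 1) / (real q)\<^sup>2 *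
      (2 * (\<Prod>j<m. 1 + lam\<^sup>2 * square_coeff (x j) (z j))
       + (real q - 2) * (\<Prod>j<m. 1 + lam\<^sup>2 * cross_coeff (x j) (z j))
       - 2 * real q * (\<Prod>j<m. 1 + lam\<^sup>2 * mean_coeff (x j)))"
    unfolding E_R E_RS using q3 by (simp add: field_simps power2_eq_square)
  finally show ?thesis .
qed

end

section \<open>Decomposition of the broadcast at the root\<close>

definition subtree :: "(nat list \<Rightarrow> nat) \<Rightarrow> nat \<Rightarrow> nat list \<Rightarrow> nat" where
  "subtree c i v = c (i # v)"

lemma Nil_notin_level_Suc [simp]: "[] \<notin> level c (Suc n)"
  by simp

text \<open>The definition extends a tree at its leaves, whereas conditioning on the root colour
  calls for splitting at the root; adding a last entry to a list commutes with removing its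
  first.\<close>

lemma level_Suc_Cons:
  "level c (Suc n) = {i # v | i v. i < c [] \<and> v \<in> level (subtree c i) n}"
proof (induction n)
  case (Suc n)
  have "level c (Suc (Suc n)) = {w @ [k] | w k. w \<in> level c (Suc n) \<and> k < c w}"
    by (rule level.simps(2))
  also have "\<dots> = {i # v | i v. i < c [] \<and> v \<in> level (subtree c i) (Suc n)}"
    proof (intro set_eqI iffI)
    fix u assume "u \<in> {w @ [k] | w k. w \<in> level c (Suc n) \<and> k < c w}"
    then obtain i v k where "u = i # (v @ [k])" "i < c []" "v \<in> level (subtree c i) n" "k < subtree c i v"
      unfolding Suc by (auto simp: subtree_def)
    then show "u \<in> {i # v | i v. i < c [] \<and> v \<in> level (subtree c i) (Suc n)}"
      by auto
  next
    fix u assume "u \<in> {i # v | i v. i < c [] \<and> v \<in> level (subtree c i) (Suc n)}"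
    then obtain i v k where u: "u = (i # v) @ [k]" "i < c []" "v \<in> level (subtree c i) n" "k < c (i # v)"
      by (auto simp: subtree_def)
    then have "i # v \<in> level c (Suc n)"
      unfolding Suc by blast
    then show "u \<in> {w @ [k] | w k. w \<in> level c (Suc n) \<and> k < c w}"
      using u(1,4) by blast
  qed
  finally show ?case .
qed auto

declare level.simps(2) [simp del]

lemma butlast_level: "v \<in> level c (Suc n) \<Longrightarrow> butlast v \<in> level c n"
  by (auto simp: level.simps(2))

text \<open>The root receives \<open>undefined\<close>, the default of \<open>Pi_pmf\<close> off a
  level, so gluing configurations of the subtrees gives a configuration of the tree as a total
  function.\<close>

definition glue :: "(nat \<Rightarrow> nat list \<Rightarrow> 'b) \<Rightarrow> nat list \<Rightarrow> 'b" where
  "glue F w = (case w of [] \<Rightarrow> undefined | i # v \<Rightarrow> F i v)"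

lemma glue_simps [simp]: "glue F [] = undefined" "glue F (i # v) = F i v"
  by (simp_all add: glue_def)

lemma inj_glue: "inj glue"
proof (rule injI)
  fix F G :: "nat \<Rightarrow> nat list \<Rightarrow> 'b"
  assume "glue F = glue G"
  then have "glue F (i # v) = glue G (i # v)" for i v by simp
  then show "F = G" by (simp add: fun_eq_iff)
qed

text \<open>Both sides weigh a function by a product over the vertices, grouped by first entry on
  the right. An absent child carries the everywhere undefined configuration, so the two support
  conditions also agree.\<close>

lemma Pi_pmf_glue:
  assumes B: "\<And>i. i < m \<Longrightarrow> finite (B i)"
  shows "Pi_pmf {i # v | i v. i < m \<and> v \<in> B i} undefined P =
    map_pmf glue (Pi_pmf {..<m} (\<lambda>_. undefined) (\<lambda>i. Pi_pmf (B i) undefined (\<lambda>v. P (i # v))))"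
    (is "Pi_pmf ?A _ _ = map_pmf _ ?Q")
proof (rule pmf_eqI)
  fix f
  have A: "?A = (\<lambda>(i, v). i # v) ` (SIGMA i:{..<m}. B i)"
    by auto
  have fin: "finite ?A"
    unfolding A using B by auto
  show "pmf (Pi_pmf ?A undefined P) f = pmf (map_pmf glue ?Q) f"
  \<comment> \<open>A function with another value at the root is not glued and has mass
    \<open>0\<close> on both sides; any other is glued from its own restrictions.\<close>
  proof (cases "f [] = undefined")
    case False
    then have "f \<notin> set_pmf (map_pmf glue ?Q)"
      by auto
    moreover have "pmf (Pi_pmf ?A undefined P) f = 0"
      using fin False by (intro pmf_Pi_outside) auto
    ultimately show ?thesis
      by (simp only: pmf_eq_0_set_pmf[symmetric])
  next
    case True
    define F where "F = (\<lambda>i v. f (i # v))"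
    have f: "f = glue F"
      using True by (auto simp: fun_eq_iff F_def glue_def split: list.split)
    have *: "(\<forall>w. w \<notin> ?A \<longrightarrow> f w = undefined) \<longleftrightarrow>
        (\<forall>i. i \<notin> {..<m} \<longrightarrow> F i = (\<lambda>_. undefined)) \<and>
        (\<forall>i<m. \<forall>v. v \<notin> B i \<longrightarrow> F i v = undefined)" (is "?l = ?r")
    proof
      assume ?l then show ?r by (auto simp: F_def fun_eq_iff)
    next
      assume r: ?r
      show ?l
      proof (intro allI impI)
        fix w assume "w \<notin> ?A"
        then show "f w = undefined"
          using r True by (cases w) (auto simp: F_def dest: fun_cong)
      qed
    qed
    have "pmf (map_pmf glue ?Q) f = pmf ?Q F"
      unfolding f by (rule pmf_map_inj'[OF inj_glue])
    also have "\<dots> = (if \<forall>i. i \<notin> {..<m} \<longrightarrow> F i = (\<lambda>_. undefined)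
        then \<Prod>i<m. pmf (Pi_pmf (B i) undefined (\<lambda>v. P (i # v))) (F i) else 0)"
      by (rule pmf_Pi) simp
    also have "\<dots> = (if \<forall>w. w \<notin> ?A \<longrightarrow> f w = undefined
        then \<Prod>i<m. \<Prod>v\<in>B i. pmf (P (i # v)) (F i v) else 0)"
    proof (cases "\<forall>i<m. \<forall>v. v \<notin> B i \<longrightarrow> F i v = undefined")
      case True
      then have "(\<Prod>i<m. pmf (Pi_pmf (B i) undefined (\<lambda>v. P (i # v))) (F i)) =
          (\<Prod>i<m. \<Prod>v\<in>B i. pmf (P (i # v)) (F i v))"
        using B by (intro prod.cong refl pmf_Pi') auto
      with True show ?thesis
        unfolding * by (intro if_cong) blast+
    next
      case False
      then obtain i where "i < m" "\<exists>v. v \<notin> B i \<and> F i v \<noteq> undefined"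
        by blast
      then have "(\<Prod>i<m. pmf (Pi_pmf (B i) undefined (\<lambda>v. P (i # v))) (F i)) = 0"
        using B by (intro prod_zero bexI[of _ i] pmf_Pi_outside) auto
      then show ?thesis
        unfolding * by (simp only: False simp_thms if_False if_cancel)
    qed
    also have "(\<Prod>i<m. \<Prod>v\<in>B i. pmf (P (i # v)) (F i v)) = (\<Prod>w\<in>?A. pmf (P w) (f w))"
      unfolding A using B
      by (subst prod.reindex) (auto simp: inj_on_def prod.Sigma F_def split_def)
    also have "(if \<forall>w. w \<notin> ?A \<longrightarrow> f w = undefined then \<dots> else 0) = pmf (Pi_pmf ?A undefined P) f"
      by (rule pmf_Pi[OF fin, symmetric])
    finally show ?thesis ..
  qed
qed

text \<open>Keeping the current level is enough, as the next one depends on nothing earlier;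
  \<open>broadcast\<close> stores all colours. \<open>level_law_eq\<close> identifies this with the
  conditional law \<open>level_law\<close>.\<close>

primrec leaf_law :: "nat \<Rightarrow> real \<Rightarrow> (nat list \<Rightarrow> nat) \<Rightarrow> nat \<Rightarrow> nat \<Rightarrow> (nat list \<Rightarrow> nat) pmf" where
  "leaf_law q p c 0 a = return_pmf ((\<lambda>_. undefined)([] := a))"
| "leaf_law q p c (Suc n) a = bind_pmf (leaf_law q p c n a)
     (\<lambda>L. Pi_pmf (level c (Suc n)) undefined (\<lambda>v. potts_row q p (L (butlast v))))"

text \<open>Given the root colour, the subtrees of the children are independent, each with a root
  colour drawn through the channel. Since the left side grows at the leaves, the induction extends
  every subtree by one level and interchanges this with the independent product.\<close>

lemma leaf_law_Suc:
  "leaf_law q p c (Suc n) a = map_pmf glue (Pi_pmf {..<c []} (\<lambda>_. undefined)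
     (\<lambda>i. mixture q p (leaf_law q p (subtree c i) n) a))"
proof (induction n)
  case 0
  have "leaf_law q p c (Suc 0) a =
      Pi_pmf {i # v | i v. i < c [] \<and> v \<in> {[]}} undefined
        (\<lambda>v. potts_row q p (((\<lambda>_. undefined)([] := a)) (butlast v)))"
    by (simp add: level_Suc_Cons bind_return_pmf)
  also have "\<dots> = map_pmf glue (Pi_pmf {..<c []} (\<lambda>_. undefined)
      (\<lambda>i. Pi_pmf {[]} undefined (\<lambda>v. potts_row q p (((\<lambda>_. undefined)([] := a)) (butlast (i # v))))))"
    by (rule Pi_pmf_glue) simp
  also have "(\<lambda>i. Pi_pmf {[]} undefined (\<lambda>v. potts_row q p (((\<lambda>_. undefined)([] := a)) (butlast (i # v))))) =
      (\<lambda>i. mixture q p (leaf_law q p (subtree c i) 0) a)"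
    by (intro ext) (auto simp: Pi_pmf_singleton mixture_def map_pmf_def fun_upd_def intro!: bind_pmf_cong)
  finally show ?case .
next
  case (Suc n)
  let ?K = "\<lambda>i L. Pi_pmf (level (subtree c i) (Suc n)) undefined (\<lambda>v. potts_row q p (L (butlast v)))"
  have K: "Pi_pmf (level c (Suc (Suc n))) undefined (\<lambda>v. potts_row q p (glue F (butlast v))) =
      map_pmf glue (Pi_pmf {..<c []} (\<lambda>_. undefined) (\<lambda>i. ?K i (F i)))" for F
  proof -
    have "Pi_pmf (level c (Suc (Suc n))) undefined (\<lambda>v. potts_row q p (glue F (butlast v))) =
      map_pmf glue (Pi_pmf {..<c []} (\<lambda>_. undefined) (\<lambda>i. Pi_pmf (level (subtree c i) (Suc n)) undefined
        (\<lambda>v. potts_row q p (glue F (butlast (i # v))))))"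
      unfolding level_Suc_Cons[of c "Suc n"] by (rule Pi_pmf_glue) (rule finite_level)
    also have "(\<lambda>i. Pi_pmf (level (subtree c i) (Suc n)) undefined
        (\<lambda>v. potts_row q p (glue F (butlast (i # v))))) = (\<lambda>i. ?K i (F i))"
    proof (intro ext Pi_pmf_cong refl finite_level)
      fix i v assume "v \<in> level (subtree c i) (Suc n)"
      then have "v \<noteq> []" by auto
      then show "potts_row q p (glue F (butlast (i # v))) = potts_row q p (F i (butlast v))"
        by simp
    qed
    finally show ?thesis .
  qed
  have "leaf_law q p c (Suc (Suc n)) a = bind_pmf (leaf_law q p c (Suc n) a)
      (\<lambda>L. Pi_pmf (level c (Suc (Suc n))) undefined (\<lambda>v. potts_row q p (L (butlast v))))"
    by (rule leaf_law.simps(2))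
  also have "\<dots> = bind_pmf (Pi_pmf {..<c []} (\<lambda>_. undefined)
        (\<lambda>i. mixture q p (leaf_law q p (subtree c i) n) a))
      (\<lambda>F. map_pmf glue (Pi_pmf {..<c []} (\<lambda>_. undefined) (\<lambda>i. ?K i (F i))))"
    unfolding Suc bind_map_pmf K ..
  also have "\<dots> = map_pmf glue (Pi_pmf {..<c []} (\<lambda>_. undefined)
      (\<lambda>i. bind_pmf (mixture q p (leaf_law q p (subtree c i) n) a) (?K i)))"
    \<comment> \<open>Independent draws followed by one independent kernel per child are an
      independent family of composed draws.\<close>
    by (subst Pi_pmf_bind[where d' = "\<lambda>_. undefined"]) (simp_all add: map_bind_pmf)
  also have "(\<lambda>i. bind_pmf (mixture q p (leaf_law q p (subtree c i) n) a) (?K i)) =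
      (\<lambda>i. mixture q p (leaf_law q p (subtree c i) (Suc n)) a)"
    by (intro ext) (auto simp: mixture_def bind_assoc_pmf intro!: bind_pmf_cong)
  finally show ?case .
qed

section \<open>Colour symmetry of the leaf law\<close>

context potts
begin

lemma leaf_law_colours:
  assumes "a \<in> {1..q}" "L \<in> set_pmf (leaf_law q p c n a)" "v \<in> level c n"
  shows "L v \<in> {1..q}"
  using assms(2,3)
proof (induction n arbitrary: L v)
  case 0
  then show ?case using assms(1) by simp
next
  case (Suc n)
  then obtain M where M: "M \<in> set_pmf (leaf_law q p c n a)"
    "L v \<in> set_pmf (potts_row q p (M (butlast v)))"
    using finite_level by (auto simp: set_Pi_pmf PiE_dflt_def)
  then have "M (butlast v) \<in> {1..q}"
    using Suc butlast_level by blast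
  then show ?case
    using set_potts_row M(2) by blast
qed

lemma finite_leaf_law:
  assumes "a \<in> {1..q}"
  shows "finite (set_pmf (leaf_law q p c n a))"
proof (induction n)
  case (Suc n)
  have "finite (set_pmf (Pi_pmf (level c (Suc n)) undefined (\<lambda>v. potts_row q p (L (butlast v)))))"
    if L: "L \<in> set_pmf (leaf_law q p c n a)" for L
  proof -
    have "finite (set_pmf (potts_row q p (L (butlast v))))" if "v \<in> level c (Suc n)" for v
      using set_potts_row[OF leaf_law_colours[OF assms L butlast_level[OF that]]]
      by (rule finite_subset) simp
    then show ?thesis
      by (simp add: set_Pi_pmf finite_level finite_PiE_dflt)
  qed
  then show ?case
    using Suc by simp
qed simp

text \<open>Values off \<open>A\<close> are kept: \<open>undefined\<close> is some natural number,
  possibly a colour that a permutation would move.\<close>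

definition recolour :: "nat list set \<Rightarrow> (nat \<Rightarrow> nat) \<Rightarrow> (nat list \<Rightarrow> nat) \<Rightarrow> nat list \<Rightarrow> nat" where
  "recolour A \<pi> L v = (if v \<in> A then \<pi> (L v) else L v)"

lemma inj_recolour:
  assumes "inj \<pi>"
  shows "inj (recolour A \<pi>)"
proof (rule injI)
  fix L M assume eq: "recolour A \<pi> L = recolour A \<pi> M"
  show "L = M"
  proof
    fix v show "L v = M v"
      using fun_cong[OF eq, of v] injD[OF assms] by (auto simp: recolour_def split: if_splits)
  qed
qed

lemma Pi_pmf_recolour:
  assumes A: "finite A" and \<pi>: "bij \<pi>"
  shows "map_pmf (recolour A \<pi>) (Pi_pmf A dflt P) = Pi_pmf A dflt (\<lambda>v. map_pmf \<pi> (P v))"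
proof (rule pmf_eqI)
  fix f
  define g where "g = recolour A (inv \<pi>) f"
  have f: "f = recolour A \<pi> g"
    using \<pi> by (auto simp: g_def recolour_def fun_eq_iff bij_is_surj surj_f_inv_f)
  show "pmf (map_pmf (recolour A \<pi>) (Pi_pmf A dflt P)) f = pmf (Pi_pmf A dflt (\<lambda>v. map_pmf \<pi> (P v))) f"
    unfolding f pmf_map_inj'[OF inj_recolour[OF bij_is_inj[OF \<pi>]]] pmf_Pi[OF A]
    by (auto simp: recolour_def pmf_map_inj'[OF bij_is_inj[OF \<pi>]] intro!: prod.cong)
qed

text \<open>An entry of the channel matrix depends only on whether its two colours coincide.\<close>

lemma potts_row_permute:
  assumes \<pi>: "\<pi> permutes {1..q}" and a: "a \<in> {1..q}"
  shows "map_pmf \<pi> (potts_row q p a) = potts_row q p (\<pi> a)"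
proof (rule pmf_eqI)
  fix j
  obtain i where j: "j = \<pi> i"
    using permutes_surj[OF \<pi>] by blast
  have "pmf (map_pmf \<pi> (potts_row q p a)) j = pmf (potts_row q p a) i"
    unfolding j by (rule pmf_map_inj'[OF permutes_inj[OF \<pi>]])
  then show "pmf (map_pmf \<pi> (potts_row q p a)) j = pmf (potts_row q p (\<pi> a)) j"
    using a q3 p0 p1 permutes_in_image[OF \<pi>] inj_eq[OF permutes_inj[OF \<pi>]]
    by (simp add: j pmf_potts_row potts_matrix_def)
qed

lemma leaf_law_permute:
  assumes \<pi>: "\<pi> permutes {1..q}" and a: "a \<in> {1..q}"
  shows "map_pmf (recolour (level c n) \<pi>) (leaf_law q p c n a) = leaf_law q p c n (\<pi> a)"
proof (induction n)
  case 0
  then show ?case by (auto simp: recolour_def fun_eq_iff)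
next
  case (Suc n)
  have "map_pmf (recolour (level c (Suc n)) \<pi>) (leaf_law q p c (Suc n) a) =
    bind_pmf (leaf_law q p c n a) (\<lambda>L. Pi_pmf (level c (Suc n)) undefined
      (\<lambda>v. map_pmf \<pi> (potts_row q p (L (butlast v)))))"
    by (simp add: map_bind_pmf Pi_pmf_recolour finite_level permutes_bij[OF \<pi>])
  also have "\<dots> = bind_pmf (leaf_law q p c n a) (\<lambda>L. Pi_pmf (level c (Suc n)) undefined
      (\<lambda>v. potts_row q p (recolour (level c n) \<pi> L (butlast v))))"
    using leaf_law_colours[OF a] butlast_level
    by (intro bind_pmf_cong refl Pi_pmf_cong finite_level)
       (auto simp: recolour_def potts_row_permute[OF \<pi>])
  also have "\<dots> = leaf_law q p c (Suc n) (\<pi> a)"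
    unfolding leaf_law.simps(2) Suc[symmetric] bind_map_pmf ..
  finally show ?case .
qed

lemma symmetric_family_leaf_law: "symmetric_family q (leaf_law q p c n)"
proof
  show "3 \<le> q" by (rule q3)
next
  fix b assume "b \<in> {1..q}"
  then show "finite (set_pmf (leaf_law q p c n b))" by (rule finite_leaf_law)
next
  fix \<pi> assume \<pi>: "\<pi> permutes {1..q}"
  show "\<exists>T. inj T \<and> (\<forall>b\<in>{1..q}. map_pmf T (leaf_law q p c n b) = leaf_law q p c n (\<pi> b))"
    using leaf_law_permute[OF \<pi>] inj_recolour[OF permutes_inj[OF \<pi>]] by blast
qed

section \<open>Moments on a fixed tree\<close>

definition tree_x :: "(nat list \<Rightarrow> nat) \<Rightarrow> nat \<Rightarrow> real" where
  "tree_x c n = symmetric_family.first_moment q (leaf_law q p c n)"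

definition tree_z :: "(nat list \<Rightarrow> nat) \<Rightarrow> nat \<Rightarrow> real" where
  "tree_z c n = symmetric_family.second_moment q (leaf_law q p c n)"

lemma tree_x_eq:
  assumes "a \<in> {1..q}"
  shows "measure_pmf.expectation (leaf_law q p c n a)
    (\<lambda>L. posterior q (leaf_law q p c n) a L - 1 / real q) = tree_x c n"
proof -
  interpret symmetric_family q "leaf_law q p c n"
    by (rule symmetric_family_leaf_law)
  show ?thesis
    using E_Y_same[OF assms] by (simp add: tree_x_def Y_def [abs_def])
qed

lemma tree_z_eq:
  assumes "a \<in> {1..q}"
  shows "measure_pmf.expectation (leaf_law q p c n a)
    (\<lambda>L. (posterior q (leaf_law q p c n) a L - 1 / real q)\<^sup>2) = tree_z c n"
proof -
  interpret symmetric_family q "leaf_law q p c n"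
    by (rule symmetric_family_leaf_law)
  show ?thesis
    using E_Y_sq_same[OF assms] by (simp add: tree_z_def Y_def [abs_def])
qed

text \<open>\<open>leaf_law_Suc\<close> presents the leaf law as the independent combination treated
  in \<open>combined_first_moment_le\<close>, with the subtrees of the children as
  components.\<close>

lemma tree_x_Suc_le:
  "tree_x c (Suc n) \<le> (real q - 1) / real q + (real q - 1) / (real q)\<^sup>2 *
      (2 * (\<Prod>j<c []. 1 + lam\<^sup>2 * square_coeff (tree_x (subtree c j) n) (tree_z (subtree c j) n))
       + (real q - 2) * (\<Prod>j<c []. 1 + lam\<^sup>2 * cross_coeff (tree_x (subtree c j) n) (tree_z (subtree c j) n))
       - 2 * real q * (\<Prod>j<c []. 1 + lam\<^sup>2 * mean_coeff (tree_x (subtree c j) n)))"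
proof -
  have "1 \<in> {1..q}" using q3 by simp
  from combined_first_moment_le[OF symmetric_family_leaf_law inj_glue leaf_law_Suc this]
  show ?thesis
    unfolding tree_x_eq[OF \<open>1 \<in> {1..q}\<close>] by (simp only: tree_x_def tree_z_def)
qed

lemma abs_expectation_leaf_law_le:
  assumes "a \<in> {1..q}" "\<And>L. \<bar>f L\<bar> \<le> 1"
  shows "\<bar>measure_pmf.expectation (leaf_law q p c n a) f\<bar> \<le> (1 :: real)"
proof -
  have "integrable (measure_pmf (leaf_law q p c n a)) f"
    using assms(1) by (intro integrable_measure_pmf_finite finite_leaf_law)
  moreover have "f L \<le> 1" "- 1 \<le> f L" for L
    using assms(2)[of L] by auto
  ultimately have "measure_pmf.expectation (leaf_law q p c n a) f \<le> 1"
      "- 1 \<le> measure_pmf.expectation (leaf_law q p c n a) f"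
    by (auto intro!: measure_pmf.integral_le_const measure_pmf.integral_ge_const)
  then show ?thesis by linarith
qed

lemma posterior_deviation_le:
  assumes "a \<in> {1..q}"
  shows "\<bar>posterior q \<mu> a l - 1 / real q\<bar> \<le> 1"
proof -
  have "0 \<le> 1 / real q" "1 / real q \<le> 1"
    using q3 by simp_all
  then show ?thesis
    using posterior_nonneg[of q \<mu> a l] posterior_le_1[OF assms, of \<mu> l] by linarith
qed

lemma tree_x_bounded: "\<bar>tree_x c n\<bar> \<le> 1"
proof -
  have 1: "1 \<in> {1..q}" using q3 by simp
  show ?thesis
    unfolding tree_x_eq[OF 1, symmetric]
    by (intro abs_expectation_leaf_law_le posterior_deviation_le 1)
qed

lemma tree_z_bounded: "\<bar>tree_z c n\<bar> \<le> 1"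
proof -
  have 1: "1 \<in> {1..q}" using q3 by simp
  have sq: "\<bar>u\<^sup>2\<bar> \<le> 1" if "\<bar>u\<bar> \<le> 1" for u :: real
    using that by (simp add: abs_square_le_1)
  show ?thesis
    unfolding tree_z_eq[OF 1, symmetric]
    by (intro abs_expectation_leaf_law_le sq posterior_deviation_le 1)
qed

end

section \<open>The posterior of the root\<close>

lemma level_config_butlast:
  "v \<in> level c (Suc n) \<Longrightarrow> level_config c n \<sigma> (butlast v) = \<sigma> (butlast v)"
  by (simp add: level_config_def butlast_level)

text \<open>Drawing a level needs only the colours of the previous one and leaves the root
  untouched, so the pair of root colour and current level evolves by the same step as
  \<open>leaf_law\<close>.\<close>

lemma root_and_level_law:
  "map_pmf (\<lambda>\<sigma>. (\<sigma> [], level_config c n \<sigma>)) (broadcast q p c n) =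
    bind_pmf (pmf_of_set {1..q}) (\<lambda>a. map_pmf (Pair a) (leaf_law q p c n a))"
proof (induction n)
  case 0
  show ?case
    by (simp add: level_config_def map_pmf_comp)
       (auto simp: map_pmf_def restrict_def fun_eq_iff intro!: bind_pmf_cong)
next
  case (Suc n)
  let ?K = "\<lambda>L. Pi_pmf (level c (Suc n)) undefined (\<lambda>v. potts_row q p (L (butlast v)))"
  have "map_pmf (\<lambda>\<sigma>. (\<sigma> [], level_config c (Suc n) \<sigma>)) (broadcast q p c (Suc n)) =
    bind_pmf (broadcast q p c n) (\<lambda>\<sigma>. map_pmf (\<lambda>\<tau>. (override_on \<sigma> \<tau> (level c (Suc n)) [],
      level_config c (Suc n) (override_on \<sigma> \<tau> (level c (Suc n))))) (?K \<sigma>))"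
    by (simp add: map_bind_pmf map_pmf_comp)
  also have "\<dots> = bind_pmf (broadcast q p c n)
      (\<lambda>\<sigma>. map_pmf (Pair (\<sigma> [])) (?K (level_config c n \<sigma>)))"
  proof (intro bind_pmf_cong refl)
    fix \<sigma>
    let ?A = "level c (Suc n)"
    have K: "?K (level_config c n \<sigma>) = ?K \<sigma>"
      by (intro Pi_pmf_cong refl finite_level) (simp only: level_config_butlast)
    \<comment> \<open>A draw \<open>\<tau>\<close> is undefined off the new level, so overriding and
      restricting again returns it; the root does not belong to that level.\<close>
    have "(override_on \<sigma> \<tau> ?A [], level_config c (Suc n) (override_on \<sigma> \<tau> ?A)) = (\<sigma> [], \<tau>)"
      if "\<tau> \<in> set_pmf (?K \<sigma>)" for \<tau>
    proof -
      have outside: "\<tau> v = undefined" if "v \<notin> ?A" for v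
        using set_Pi_pmf_subset[OF finite_level, THEN subsetD, OF \<open>\<tau> \<in> set_pmf (?K \<sigma>)\<close>,
          unfolded mem_Collect_eq, rule_format, OF that] .
      have "level_config c (Suc n) (override_on \<sigma> \<tau> ?A) = \<tau>"
      proof
        fix v show "level_config c (Suc n) (override_on \<sigma> \<tau> ?A) v = \<tau> v"
          by (cases "v \<in> ?A") (simp_all only: level_config_def restrict_apply override_on_def outside
            if_True if_False not_False_eq_True)
      qed
      then show ?thesis
        by (simp only: override_on_def Nil_notin_level_Suc if_False)
    qed
    then show "map_pmf (\<lambda>\<tau>. (override_on \<sigma> \<tau> ?A [], level_config c (Suc n) (override_on \<sigma> \<tau> ?A))) (?K \<sigma>) =
      map_pmf (Pair (\<sigma> [])) (?K (level_config c n \<sigma>))"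
      unfolding K by (intro map_pmf_cong refl)
  qed
  also have "\<dots> = bind_pmf (map_pmf (\<lambda>\<sigma>. (\<sigma> [], level_config c n \<sigma>)) (broadcast q p c n))
      (\<lambda>(b, L). map_pmf (Pair b) (?K L))"
    by (simp add: bind_map_pmf)
  also have "\<dots> = bind_pmf (pmf_of_set {1..q}) (\<lambda>a. map_pmf (Pair a) (leaf_law q p c (Suc n) a))"
    unfolding Suc by (simp add: bind_assoc_pmf bind_map_pmf map_bind_pmf)
  finally show ?case .
qed

section \<open>Bayes' rule for a uniform hidden colour\<close>

context
  fixes q :: nat and J :: "(nat \<times> 'l) pmf" and \<mu> :: "nat \<Rightarrow> 'l pmf"
  assumes q1: "1 \<le> q"
    and J: "J = bind_pmf (pmf_of_set {1..q}) (\<lambda>a. map_pmf (Pair a) (\<mu> a))"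
begin

lemma pmf_uniform_root:
  "pmf J (a, l) = (if a \<in> {1..q} then pmf (\<mu> a) l / real q else 0)"
proof -
  have "pmf (map_pmf (Pair b) (\<mu> b)) (a, l) = (if b = a then pmf (\<mu> a) l else 0)" for b
  proof (cases "b = a")
    case True
    then show ?thesis
      by (simp add: pmf_map_inj' inj_on_def)
  next
    case False
    then have "(a, l) \<notin> set_pmf (map_pmf (Pair b) (\<mu> b))" by auto
    then have "pmf (map_pmf (Pair b) (\<mu> b)) (a, l) = 0" by (rule pmf_eq_0_set_pmf[THEN iffD2])
    then show ?thesis
      using False by simp
  qed
  then show ?thesis
    using q1 by (simp add: J pmf_bind_pmf_of_set if_distrib[of "\<lambda>x. x / _"])
qed

lemma map_fst_uniform_root: "map_pmf fst J = pmf_of_set {1..q}"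
  by (simp add: J map_bind_pmf map_pmf_comp map_pmf_const bind_return_pmf')

lemma cond_uniform_root:
  assumes a: "a \<in> {1..q}"
  shows "cond_pmf J (fst -` {a}) = map_pmf (Pair a) (\<mu> a)"
proof -
  have meas: "measure_pmf.prob J (fst -` {a}) = 1 / real q"
    using map_fst_uniform_root pmf_map[of fst J a] a q1 by simp
  then have ne: "set_pmf J \<inter> fst -` {a} \<noteq> {}"
    using q1 measure_pmf_zero_iff[of J "fst -` {a}"] by auto
  show ?thesis
  proof (rule pmf_eqI)
    fix y :: "nat \<times> 'l"
    obtain b l where y: "y = (b, l)" by (cases y)
    show "pmf (cond_pmf J (fst -` {a})) y = pmf (map_pmf (Pair a) (\<mu> a)) y"
    proof (cases "b = a")
      case True
      then show ?thesis
        using a q1 unfolding y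
        by (simp add: pmf_cond[OF ne] meas pmf_uniform_root pmf_map_inj' inj_on_def)
    next
      case False
      then have "y \<notin> set_pmf (map_pmf (Pair a) (\<mu> a))" unfolding y by auto
      then have "pmf (map_pmf (Pair a) (\<mu> a)) y = 0" by (rule pmf_eq_0_set_pmf[THEN iffD2])
      then show ?thesis
        using False by (simp add: pmf_cond[OF ne] y)
    qed
  qed
qed

lemma pmf_snd_uniform_root: "pmf (map_pmf snd J) l = (\<Sum>a=1..q. pmf (\<mu> a) l) / real q"
  using q1 by (simp add: J map_bind_pmf map_pmf_comp pmf_bind_pmf_of_set)

end

text \<open>The event concerns the root only, so conditioning may be done after mapping to the pair
  of root colour and configuration, where \<open>cond_uniform_root\<close> applies.\<close>

lemma level_law_eq:
  assumes "1 \<le> q" "a \<in> {1..q}"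
  shows "level_law q p c n a = leaf_law q p c n a"
proof -
  let ?h = "\<lambda>\<sigma>. (\<sigma> [], level_config c n \<sigma>)"
  let ?J = "map_pmf ?h (broadcast q p c n)"
  have "a \<in> fst ` set_pmf ?J"
    using arg_cong[OF map_fst_uniform_root[OF assms(1) root_and_level_law], of set_pmf] assms
    by (simp only: set_map_pmf) simp
  then have ne: "set_pmf (broadcast q p c n) \<inter> ?h -` (fst -` {a}) \<noteq> {}"
    by auto
  have "leaf_law q p c n a = map_pmf snd (cond_pmf ?J (fst -` {a}))"
    unfolding cond_uniform_root[OF assms(1) root_and_level_law assms(2)]
    by (simp add: map_pmf_comp)
  also have "\<dots> = level_law q p c n a"
    unfolding cond_map_pmf[OF ne] level_law_def by (simp add: map_pmf_comp vimage_def)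
  finally show ?thesis ..
qed

text \<open>The factor \<open>1 / q\<close> cancels between joint and marginal mass. For
  configurations of mass zero, both sides are \<open>0\<close> by division by zero.\<close>

lemma root_posterior_eq:
  assumes "1 \<le> q" "a \<in> {1..q}"
  shows "root_posterior q p c n a L = posterior q (leaf_law q p c n) a L"
proof -
  let ?h = "\<lambda>\<sigma>. (\<sigma> [], level_config c n \<sigma>)"
  let ?J = "map_pmf ?h (broadcast q p c n)"
  have "measure_pmf.prob (broadcast q p c n) {\<sigma>. \<sigma> [] = a \<and> level_config c n \<sigma> = L} =
      pmf (leaf_law q p c n a) L / real q"
    using pmf_uniform_root[OF assms(1) root_and_level_law, of c n p a L] assms(2)
      pmf_map[of ?h "broadcast q p c n" "(a, L)"]
    by (simp add: vimage_def)
  moreover have "measure_pmf.prob (broadcast q p c n) {\<sigma>. level_config c n \<sigma> = L} =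
      (\<Sum>b=1..q. pmf (leaf_law q p c n b) L) / real q"
    using pmf_snd_uniform_root[OF assms(1) root_and_level_law, of c n p L]
      pmf_map[of "level_config c n" "broadcast q p c n" L]
    by (simp add: vimage_def map_pmf_comp)
  ultimately show ?thesis
    using assms(1) by (simp add: root_posterior_def cond_prob_def posterior_def)
qed

context potts
begin

lemma x_moment_eq:
  assumes "a \<in> {1..q}"
  shows "x_moment q p d a n = (\<integral>c. tree_x c n \<partial>galton_watson d)"
  using assms q3
  by (simp add: x_moment_def broadcast_expectation_def Y_plus_def [abs_def] level_law_eq
    root_posterior_eq tree_x_eq)

lemma z_moment_eq:
  assumes "a \<in> {1..q}"
  shows "z_moment q p d a n = (\<integral>c. tree_z c n \<partial>galton_watson d)"
  using assms q3
  by (simp add: z_moment_def broadcast_expectation_def Y_plus_def [abs_def] level_law_eq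
    root_posterior_eq tree_z_eq)

end

section \<open>Averaging over Galton--Watson trees\<close>

lemma prob_space_galton_watson: "prob_space (galton_watson d)"
  unfolding galton_watson_def by (intro prob_space_PiM measure_pmf.prob_space_axioms)

lemma space_galton_watson [simp]: "space (galton_watson d) = UNIV"
  by (simp add: galton_watson_def space_PiM)

section \<open>Measurability of functions of the tree\<close>

lemma component_measurable: "(\<lambda>c. c v) \<in> galton_watson d \<rightarrow>\<^sub>M count_space UNIV"
  unfolding galton_watson_def
  using measurable_component_singleton[of v UNIV "\<lambda>_. measure_pmf d"] by simp

text \<open>Every preimage is a union of cylinder sets. Vertices and child counts are countable, so
  there are only countably many cylinders and the union is measurable. The set \<open>S\<close> may
  depend on \<open>c\<close>.\<close>

lemma locally_determined_measurable:
  fixes f :: "(nat list \<Rightarrow> nat) \<Rightarrow> real"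
  assumes "\<And>c. \<exists>S. finite S \<and> (\<forall>c'. (\<forall>v\<in>S. c' v = c v) \<longrightarrow> f c' = f c)"
  shows "f \<in> borel_measurable (galton_watson d)"
proof (rule measurableI)
  fix A :: "real set"
  define cyl :: "(nat list \<times> nat) list \<Rightarrow> (nat list \<Rightarrow> nat) set"
    where "cyl ps = {c. \<forall>x\<in>set ps. c (fst x) = snd x}" for ps
  have cyl: "cyl ps \<in> sets (galton_watson d)" for ps
  proof -
    have "{c \<in> space (galton_watson d). c v = k} \<in> sets (galton_watson d)" for v k
      using measurable_sets[OF component_measurable, of "{k}" v d] by (simp add: vimage_def)
    then have "{c \<in> space (galton_watson d). \<forall>x\<in>set ps. c (fst x) = snd x} \<in> sets (galton_watson d)"
      by (intro sets.sets_Collect_finite_All) auto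
    then show ?thesis by (simp add: cyl_def)
  qed
  have "f -` A = (\<Union>ps\<in>{ps. cyl ps \<subseteq> f -` A}. cyl ps)"
  proof (intro equalityI subsetI)
    fix c assume c: "c \<in> f -` A"
    obtain S where S: "finite S" "\<And>c'. (\<forall>v\<in>S. c' v = c v) \<Longrightarrow> f c' = f c"
      using assms by blast
    obtain vs where vs: "set vs = S"
      using finite_list[OF S(1)] by blast
    have "cyl (map (\<lambda>v. (v, c v)) vs) \<subseteq> f -` A"
    proof
      fix c' assume "c' \<in> cyl (map (\<lambda>v. (v, c v)) vs)"
      then have "\<forall>v\<in>S. c' v = c v"
        using vs by (simp add: cyl_def)
      then have "f c' = f c" by (rule S(2))
      then show "c' \<in> f -` A" using c by simp
    qed
    moreover have "c \<in> cyl (map (\<lambda>v. (v, c v)) vs)"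
      by (simp add: cyl_def)
    ultimately show "c \<in> (\<Union>ps\<in>{ps. cyl ps \<subseteq> f -` A}. cyl ps)" by blast
  qed auto
  moreover have "(\<Union>ps\<in>{ps. cyl ps \<subseteq> f -` A}. cyl ps) \<in> sets (galton_watson d)"
    using cyl by (intro sets.countable_UN'') auto
  ultimately show "f -` A \<inter> space (galton_watson d) \<in> sets (galton_watson d)"
    by (simp only: space_galton_watson Int_UNIV_right)
qed simp

lemma level_cong:
  assumes "\<And>v k. k < n \<Longrightarrow> v \<in> level c k \<Longrightarrow> c' v = c v"
  shows "level c' n = level c n"
  using assms
proof (induction n)
  case (Suc n)
  have "level c' n = level c n"
  proof (rule Suc.IH)
    fix v k assume "k < n" "v \<in> level c k"
    then show "c' v = c v"
      by (intro Suc.prems[of k]) simp_all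
  qed
  moreover have "c' v = c v" if "v \<in> level c n" for v
    by (rule Suc.prems[OF lessI that])
  ultimately have "v \<in> level c' n \<and> i < c' v \<longleftrightarrow> v \<in> level c n \<and> i < c v" for v i
    by metis
  then show ?case
    unfolding level.simps(2) by (simp only:)
qed simp

lemma leaf_law_cong:
  assumes "\<And>k. k \<le> n \<Longrightarrow> level c' k = level c k"
  shows "leaf_law q p c' n a = leaf_law q p c n a"
  using assms
proof (induction n)
  case (Suc n)
  have "leaf_law q p c' n a = leaf_law q p c n a"
    by (rule Suc.IH) (rule Suc.prems, simp)
  then show ?case
    by (simp only: leaf_law.simps Suc.prems[OF order.refl])
qed simp

text \<open>The law at level \<open>n\<close> reads only the child counts of vertices at smaller
  levels, which are finitely many but depend on the tree.\<close>

lemma leaf_law_locally_determined: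
  "\<exists>S. finite S \<and> (\<forall>c'. (\<forall>v\<in>S. c' v = c v) \<longrightarrow> leaf_law q p c' n = leaf_law q p c n)"
proof (intro exI conjI allI impI)
  show "finite (\<Union>k\<in>{..<n}. level c k)"
    by (simp add: finite_level)
  fix c' assume c': "\<forall>v\<in>(\<Union>k\<in>{..<n}. level c k). c' v = c v"
  show "leaf_law q p c' n = leaf_law q p c n"
    by (intro ext leaf_law_cong level_cong bspec[OF c'] UN_I[of _ "{..<n}"]) simp_all
qed

section \<open>Independence of the root's degree and the subtrees\<close>

lemma distr_component: "distr (galton_watson d) (measure_pmf d) (\<lambda>c. c v) = measure_pmf d"
  unfolding galton_watson_def
  by (rule distr_PiM_component) (auto intro: measure_pmf.prob_space_axioms)

lemma indep_components:
  "prob_space.indep_vars (galton_watson d) (\<lambda>_. measure_pmf d) (\<lambda>v c. c v) UNIV"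
proof -
  interpret prob_space "galton_watson d" by (rule prob_space_galton_watson)
  show ?thesis
    by (subst indep_vars_iff_distr_eq_PiM)
       (auto simp: component_measurable distr_component restrict_UNIV
         simp flip: galton_watson_def intro!: distr_id2)
qed

lemma subtree_measurable: "(\<lambda>c. subtree c j) \<in> galton_watson d \<rightarrow>\<^sub>M galton_watson d"
proof -
  have "(\<lambda>c v. c (j # v)) \<in> galton_watson d \<rightarrow>\<^sub>M (\<Pi>\<^sub>M v\<in>UNIV. measure_pmf d)"
    by (intro measurable_abs_UNIV) (simp add: component_measurable)
  then show ?thesis
    by (simp add: subtree_def [abs_def] flip: galton_watson_def)
qed

text \<open>Prefixing \<open>j\<close> injects the vertices into themselves, and reindexing a
  product of copies of one law along an injection gives the same product.\<close>

lemma distr_subtree: "distr (galton_watson d) (galton_watson d) (\<lambda>c. subtree c j) = galton_watson d"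
  using distr_PiM_reindex[of UNIV "\<lambda>_. measure_pmf d" "\<lambda>v. j # v" UNIV]
  by (simp add: galton_watson_def subtree_def [abs_def] measure_pmf.prob_space_axioms restrict_UNIV)

context
  fixes d :: "nat pmf" and G :: "(nat list \<Rightarrow> nat) \<Rightarrow> real" and B :: real
  assumes G: "G \<in> borel_measurable (galton_watson d)" and B: "\<And>c. \<bar>G c\<bar> \<le> B"
begin

lemma integrable_bounded: "integrable (galton_watson d) G"
proof -
  interpret prob_space "galton_watson d" by (rule prob_space_galton_watson)
  show ?thesis
    by (rule integrable_const_bound[of _ B]) (use B G in auto)
qed

lemma integral_subtree: "(\<integral>c. G (subtree c j) \<partial>galton_watson d) = (\<integral>c. G c \<partial>galton_watson d)"
  using integral_distr[OF subtree_measurable G, of j] by (simp add: distr_subtree)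

lemma integrable_subtree: "integrable (galton_watson d) (\<lambda>c. G (subtree c j))"
  using integrable_distr_eq[OF subtree_measurable G, of j] integrable_bounded
  by (simp add: distr_subtree)

lemma integrable_root_eq: "integrable (galton_watson d) (\<lambda>c. indicator {k} (c []) :: real)"
proof -
  interpret prob_space "galton_watson d" by (rule prob_space_galton_watson)
  show ?thesis
    by (rule integrable_const_bound[of _ 1])
       (auto intro!: measurable_compose[OF component_measurable] simp: indicator_def)
qed

lemma integral_root_eq: "(\<integral>c. indicator {k} (c []) \<partial>galton_watson d) = pmf d k"
proof -
  show ?thesis
    using integral_distr[of "\<lambda>c. c []" "galton_watson d" "measure_pmf d" "indicator {k} :: nat \<Rightarrow> real"]
    by (simp add: component_measurable distr_component measure_pmf_single)
qed

text \<open>The root and, for each \<open>j\<close>, the lists starting with \<open>j\<close> form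
  disjoint sets of coordinates. \<open>case_nat\<close> packs everything into one family: index
  \<open>0\<close> is the root, index \<open>Suc j\<close> the subtree of child
  \<open>j\<close>.\<close>

lemma root_subtrees_indep:
  "prob_space.indep_vars (galton_watson d) (\<lambda>_. borel)
    (case_nat (\<lambda>c. indicator {k} (c [])) (\<lambda>j c. G (subtree c j))) UNIV"
proof -
  interpret prob_space "galton_watson d" by (rule prob_space_galton_watson)
  define K :: "nat \<Rightarrow> nat list set" where "K = case_nat {[]} (\<lambda>j. range ((#) j))"
  define h :: "nat \<Rightarrow> (nat list \<Rightarrow> nat) \<Rightarrow> real"
    where "h = case_nat (\<lambda>c. indicator {k} (c [])) (\<lambda>j c. G (subtree c j))"
  have "disjoint_family_on K UNIV"
    by (auto simp: disjoint_family_on_def K_def split: nat.splits)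
  then have "indep_vars (\<lambda>j. PiM (K j) (\<lambda>_. measure_pmf d)) (\<lambda>j c. restrict (\<lambda>v. c v) (K j)) UNIV"
    by (intro indep_vars_restrict[OF indep_components]) auto
  then have "indep_vars (\<lambda>_. borel) (\<lambda>j c. h j (restrict (\<lambda>v. c v) (K j))) UNIV"
  proof (rule indep_vars_compose2)
    fix j
    show "h j \<in> borel_measurable (PiM (K j) (\<lambda>_. measure_pmf d))"
    proof (cases j)
      case 0
      have "(\<lambda>c. c []) \<in> PiM (K 0) (\<lambda>_. measure_pmf d) \<rightarrow>\<^sub>M measure_pmf d"
        by (rule measurable_component_singleton) (simp add: K_def)
      then show ?thesis
        unfolding 0 h_def by (auto intro: measurable_compose)
    next
      case (Suc i)
      have "(\<lambda>c v. c (i # v)) \<in> PiM (K j) (\<lambda>_. measure_pmf d) \<rightarrow>\<^sub>M (\<Pi>\<^sub>M v\<in>UNIV. measure_pmf d)"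
        by (intro measurable_abs_UNIV measurable_component_singleton) (simp add: K_def Suc)
      then have "(\<lambda>c. subtree c i) \<in> PiM (K j) (\<lambda>_. measure_pmf d) \<rightarrow>\<^sub>M galton_watson d"
        by (simp add: subtree_def [abs_def] galton_watson_def)
      then show ?thesis
        using G by (simp add: h_def Suc)
    qed
  qed
  moreover have "h j (restrict (\<lambda>v. c v) (K j)) = h j c" for j c
    by (cases j) (auto simp: h_def K_def subtree_def [abs_def])
  ultimately show ?thesis
    by (simp add: h_def)
qed

text \<open>The indicator fixes the number of children, so the product has a fixed length and
  independence applies.\<close>

lemma integral_root_subtrees:
  "(\<integral>c. indicator {k} (c []) * (\<Prod>j<k. G (subtree c j)) \<partial>galton_watson d) =
    pmf d k * (\<integral>c. G c \<partial>galton_watson d) ^ k"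
  "integrable (galton_watson d) (\<lambda>c. indicator {k} (c []) * (\<Prod>j<k. G (subtree c j)))"
proof -
  interpret prob_space "galton_watson d" by (rule prob_space_galton_watson)
  define X where "X = case_nat (\<lambda>c. indicator {k} (c [])) (\<lambda>j c. G (subtree c j))"
  have X_simps: "X 0 = (\<lambda>c. indicator {k} (c []))" "X (Suc j) = (\<lambda>c. G (subtree c j))" for j
    by (simp_all add: X_def)
  have int: "integrable (galton_watson d) (X j)" for j
    by (cases j) (simp_all add: X_simps integrable_root_eq integrable_subtree)
  have indep: "indep_vars (\<lambda>_. borel) X {..<Suc k}"
    using root_subtrees_indep unfolding X_def by (rule indep_vars_subset) simp
  have split: "(\<Prod>j<Suc k. u j) = u 0 * (\<Prod>j<k. u (Suc j))" for u :: "nat \<Rightarrow> real"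
    by (rule prod.lessThan_Suc_shift)
  have "(\<integral>c. (\<Prod>j<Suc k. X j c) \<partial>galton_watson d) = (\<Prod>j<Suc k. \<integral>c. X j c \<partial>galton_watson d)"
    by (rule indep_vars_lebesgue_integral[OF _ indep int]) simp
  then show "(\<integral>c. indicator {k} (c []) * (\<Prod>j<k. G (subtree c j)) \<partial>galton_watson d) =
    pmf d k * (\<integral>c. G c \<partial>galton_watson d) ^ k"
    unfolding split X_simps by (simp add: integral_root_eq integral_subtree)
  have "integrable (galton_watson d) (\<lambda>c. \<Prod>j<Suc k. X j c)"
    by (rule indep_vars_integrable[OF _ indep int]) simp
  then show "integrable (galton_watson d) (\<lambda>c. indicator {k} (c []) * (\<Prod>j<k. G (subtree c j)))"
    unfolding split X_simps .
qed

text \<open>Almost surely the root degree lies in the finite support, which turns the product of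
  random length into a finite sum over the possible degrees.\<close>

lemma branching:
  assumes d: "finite (set_pmf d)"
  shows "(\<integral>c. (\<Prod>j<c []. G (subtree c j)) \<partial>galton_watson d) =
      measure_pmf.expectation d (\<lambda>k. (\<integral>c. G c \<partial>galton_watson d) ^ k)"
    and "integrable (galton_watson d) (\<lambda>c. \<Prod>j<c []. G (subtree c j))"
proof -
  let ?f = "\<lambda>c. \<Sum>k\<in>set_pmf d. indicator {k} (c []) * (\<Prod>j<k. G (subtree c j))"
  have "AE c in galton_watson d. c [] \<in> set_pmf d"
    unfolding galton_watson_def
    by (rule AE_PiM_component) (auto intro: measure_pmf.prob_space_axioms AE_pmfI)
  then have AE: "AE c in galton_watson d. (\<Prod>j<c []. G (subtree c j)) = ?f c"
  proof eventually_elim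
    case (elim c)
    have "?f c = (\<Sum>k\<in>set_pmf d. if c [] = k then \<Prod>j<k. G (subtree c j) else 0)"
      by (intro sum.cong) auto
    then show ?case
      using elim d by simp
  qed
  have meas: "(\<lambda>c. \<Prod>j<c []. G (subtree c j)) \<in> borel_measurable (galton_watson d)"
    by (rule measurable_compose_countable[where f = "\<lambda>k c. \<Prod>j<k. G (subtree c j)"])
       (intro borel_measurable_prod measurable_compose[OF subtree_measurable G] component_measurable)+
  have int: "integrable (galton_watson d) ?f"
    by (intro Bochner_Integration.integrable_sum integral_root_subtrees)
  show "integrable (galton_watson d) (\<lambda>c. \<Prod>j<c []. G (subtree c j))"
    by (rule integrable_cong_AE_imp[OF int meas]) (rule eventually_mono[OF AE sym])
  have "(\<integral>c. (\<Prod>j<c []. G (subtree c j)) \<partial>galton_watson d) = (\<integral>c. ?f c \<partial>galton_watson d)"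
    by (rule integral_cong_AE[OF meas borel_measurable_integrable[OF int] AE])
  also have "\<dots> = (\<Sum>k\<in>set_pmf d. pmf d k * (\<integral>c. G c \<partial>galton_watson d) ^ k)"
    by (subst Bochner_Integration.integral_sum) (auto simp: integral_root_subtrees)
  also have "\<dots> = measure_pmf.expectation d (\<lambda>k. (\<integral>c. G c \<partial>galton_watson d) ^ k)"
    by (subst integral_measure_pmf[OF d]) auto
  finally show "(\<integral>c. (\<Prod>j<c []. G (subtree c j)) \<partial>galton_watson d) =
      measure_pmf.expectation d (\<lambda>k. (\<integral>c. G c \<partial>galton_watson d) ^ k)" .
qed

end

lemma expectation_one_plus_power:
  fixes d :: "nat pmf" and u :: real
  assumes d: "finite (set_pmf d)" and m: "\<And>k. k \<in> set_pmf d \<Longrightarrow> k \<le> m"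
  shows "measure_pmf.expectation d (\<lambda>k. (1 + u) ^ k) =
    1 + measure_pmf.expectation d real * u
      + (\<Sum>j=2..m. measure_pmf.expectation d (\<lambda>k. real (k choose j)) * u ^ j)"
proof -
  have int [simp]: "integrable (measure_pmf d) f" for f :: "nat \<Rightarrow> real"
    by (rule integrable_measure_pmf_finite[OF d])
  have expand: "(1 + u) ^ k = 1 + real k * u + (\<Sum>j=2..m. real (k choose j) * u ^ j)"
    if "k \<in> set_pmf d" for k
  proof -
    have "(1 + u) ^ k = (\<Sum>j\<le>k. real (k choose j) * u ^ j)"
      using binomial_ring[of u 1 k] by (simp add: add.commute)
    \<comment> \<open>Running to \<open>Suc m\<close> keeps the indices \<open>0\<close> and
      \<open>1\<close> in range even for \<open>m = 0\<close>; the added terms vanish as they have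
      \<open>j > k\<close>.\<close>
    also have "\<dots> = (\<Sum>j\<le>Suc m. real (k choose j) * u ^ j)"
      using m[OF that] by (intro sum.mono_neutral_left) (auto simp: binomial_eq_0)
    also have "\<dots> = 1 + real k * u + (\<Sum>j=2..Suc m. real (k choose j) * u ^ j)"
    proof -
      have "{..Suc m} = {0, 1} \<union> {2..Suc m}" by auto
      then show ?thesis by (simp add: sum.union_disjoint)
    qed
    also have "(\<Sum>j=2..Suc m. real (k choose j) * u ^ j) = (\<Sum>j=2..m. real (k choose j) * u ^ j)"
      using m[OF that] by (intro sum.mono_neutral_right) (auto simp: binomial_eq_0)
    finally show ?thesis .
  qed
  have "measure_pmf.expectation d (\<lambda>k. (1 + u) ^ k) =
      measure_pmf.expectation d (\<lambda>k. 1 + real k * u + (\<Sum>j=2..m. real (k choose j) * u ^ j))"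
    by (intro integral_cong_AE) (auto simp: AE_measure_pmf_iff expand)
  then show ?thesis by simp
qed

section \<open>Recursion for the averaged moments\<close>

context potts
begin

lemma tree_x_measurable: "(\<lambda>c. tree_x c n) \<in> borel_measurable (galton_watson d)"
  by (rule locally_determined_measurable)
     (metis (no_types, lifting) leaf_law_locally_determined tree_x_def)

lemma tree_z_measurable: "(\<lambda>c. tree_z c n) \<in> borel_measurable (galton_watson d)"
  by (rule locally_determined_measurable)
     (metis (no_types, lifting) leaf_law_locally_determined tree_z_def)

lemma tree_x_integrable: "integrable (galton_watson d) (\<lambda>c. tree_x c n)"
  by (rule integrable_bounded[OF tree_x_measurable tree_x_bounded])

lemma tree_z_integrable: "integrable (galton_watson d) (\<lambda>c. tree_z c n)"
  by (rule integrable_bounded[OF tree_z_measurable tree_z_bounded])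

text \<open>An affine function of \<open>tree_x\<close> and \<open>tree_z\<close> has as its mean
  the same function of the averaged moments; the bounds on both supply what \<open>branching\<close>
  asks for.\<close>

lemma branching_affine:
  fixes d :: "nat pmf" and n :: nat and \<alpha> \<beta> \<gamma> :: real
  assumes d: "finite (set_pmf d)"
  defines "G \<equiv> \<lambda>c. \<alpha> + \<beta> * tree_x c n + \<gamma> * tree_z c n"
  shows "(\<integral>c. (\<Prod>j<c []. G (subtree c j)) \<partial>galton_watson d) =
      measure_pmf.expectation d (\<lambda>k. (\<alpha> + \<beta> * (\<integral>c. tree_x c n \<partial>galton_watson d)
        + \<gamma> * (\<integral>c. tree_z c n \<partial>galton_watson d)) ^ k)"
    and "integrable (galton_watson d) (\<lambda>c. \<Prod>j<c []. G (subtree c j))"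
proof -
  interpret prob_space "galton_watson d" by (rule prob_space_galton_watson)
  have meas: "G \<in> borel_measurable (galton_watson d)"
    unfolding G_def
    by (intro borel_measurable_add borel_measurable_times borel_measurable_const
      tree_x_measurable tree_z_measurable)
  have bound: "\<bar>G c\<bar> \<le> \<bar>\<alpha>\<bar> + \<bar>\<beta>\<bar> + \<bar>\<gamma>\<bar>" for c
  proof -
    have "\<bar>\<beta> * tree_x c n\<bar> \<le> \<bar>\<beta>\<bar>" "\<bar>\<gamma> * tree_z c n\<bar> \<le> \<bar>\<gamma>\<bar>"
      using tree_x_bounded[of c n] tree_z_bounded[of c n] by (simp_all add: abs_mult mult_left_le)
    then show ?thesis unfolding G_def by linarith
  qed
  have "(\<integral>c. G c \<partial>galton_watson d) = \<alpha> + \<beta> * (\<integral>c. tree_x c n \<partial>galton_watson d)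
      + \<gamma> * (\<integral>c. tree_z c n \<partial>galton_watson d)"
    unfolding G_def by (simp add: tree_x_integrable tree_z_integrable prob_space [simplified])
  then show "(\<integral>c. (\<Prod>j<c []. G (subtree c j)) \<partial>galton_watson d) =
      measure_pmf.expectation d (\<lambda>k. (\<alpha> + \<beta> * (\<integral>c. tree_x c n \<partial>galton_watson d)
        + \<gamma> * (\<integral>c. tree_z c n \<partial>galton_watson d)) ^ k)"
    using branching(1)[OF meas bound d] by simp
  show "integrable (galton_watson d) (\<lambda>c. \<Prod>j<c []. G (subtree c j))"
    by (rule branching(2)[OF meas bound d])
qed

lemma expected_tree_x_Suc_le:
  fixes d :: "nat pmf" and n :: nat
  assumes d: "finite (set_pmf d)"
  defines "x \<equiv> \<integral>c. tree_x c n \<partial>galton_watson d" and "z \<equiv> \<integral>c. tree_z c n \<partial>galton_watson d"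
  shows "(\<integral>c. tree_x c (Suc n) \<partial>galton_watson d) \<le> (real q - 1) / real q + (real q - 1) / (real q)\<^sup>2 *
    (2 * measure_pmf.expectation d (\<lambda>k. (1 + lam\<^sup>2 * square_coeff x z) ^ k)
     + (real q - 2) * measure_pmf.expectation d (\<lambda>k. (1 + lam\<^sup>2 * cross_coeff x z) ^ k)
     - 2 * real q * measure_pmf.expectation d (\<lambda>k. (1 + lam\<^sup>2 * mean_coeff x) ^ k))"
proof -
  interpret prob_space "galton_watson d" by (rule prob_space_galton_watson)
  let ?S = "\<lambda>c. \<Prod>j<c []. 1 + lam\<^sup>2 * square_coeff (tree_x (subtree c j) n) (tree_z (subtree c j) n)"
  let ?C = "\<lambda>c. \<Prod>j<c []. 1 + lam\<^sup>2 * cross_coeff (tree_x (subtree c j) n) (tree_z (subtree c j) n)"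
  let ?M = "\<lambda>c. \<Prod>j<c []. 1 + lam\<^sup>2 * mean_coeff (tree_x (subtree c j) n)"
  \<comment> \<open>The three factors are put into the affine form of
    \<open>branching_affine\<close>; in \<open>mean\<close> the coefficient of the second moment is
    \<open>0\<close>.\<close>
  have square: "1 + lam\<^sup>2 * square_coeff u v = 1 + lam\<^sup>2 * (real q * (real q - 3 + lam) / (real q - 1)) * u
      + lam\<^sup>2 * (- ((real q)\<^sup>2 * lam / (real q - 1))) * v" for u v
    by (simp add: square_coeff_def right_diff_distrib)
  have cross: "1 + lam\<^sup>2 * cross_coeff u v =
      1 + lam\<^sup>2 * (- (real q * (3 * real q - 6 + 2 * lam) / ((real q - 1) * (real q - 2)))) * u
      + lam\<^sup>2 * (2 * (real q)\<^sup>2 * lam / ((real q - 1) * (real q - 2))) * v" for u v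
    by (simp only: cross_coeff_def distrib_left mult.assoc add.assoc)
  have mean: "1 + lam\<^sup>2 * mean_coeff u = 1 + lam\<^sup>2 * (- (real q / (real q - 1))) * u + 0 * v" for u v
    by (simp add: mean_coeff_def)
  have S: "integral\<^sup>L (galton_watson d) ?S =
        measure_pmf.expectation d (\<lambda>k. (1 + lam\<^sup>2 * square_coeff x z) ^ k)"
      "integrable (galton_watson d) ?S"
    unfolding square x_def z_def by (rule branching_affine[OF d])+
  have C: "integral\<^sup>L (galton_watson d) ?C =
        measure_pmf.expectation d (\<lambda>k. (1 + lam\<^sup>2 * cross_coeff x z) ^ k)"
      "integrable (galton_watson d) ?C"
    unfolding cross x_def z_def by (rule branching_affine[OF d])+
  have M: "integral\<^sup>L (galton_watson d) ?M =
        measure_pmf.expectation d (\<lambda>k. (1 + lam\<^sup>2 * mean_coeff x) ^ k)"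
      "integrable (galton_watson d) ?M"
    using branching_affine[OF d, of 1 "lam\<^sup>2 * (- (real q / (real q - 1)))" n 0]
    by (simp_all only: mean[symmetric] x_def)
  have "(\<integral>c. tree_x c (Suc n) \<partial>galton_watson d) \<le>
    (\<integral>c. (real q - 1) / real q + (real q - 1) / (real q)\<^sup>2 *
      (2 * ?S c + (real q - 2) * ?C c - 2 * real q * ?M c) \<partial>galton_watson d)"
    by (rule integral_mono) (simp_all only: tree_x_Suc_le tree_x_integrable S C M
      Bochner_Integration.integrable_add Bochner_Integration.integrable_diff
      integrable_mult_right integrable_const simp_thms)
  also have "\<dots> = (real q - 1) / real q + (real q - 1) / (real q)\<^sup>2 *
      (2 * integral\<^sup>L (galton_watson d) ?S + (real q - 2) * integral\<^sup>L (galton_watson d) ?C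
       - 2 * real q * integral\<^sup>L (galton_watson d) ?M)"
    using S(2) C(2) M(2) by (simp add: prob_space [simplified])
  finally show ?thesis
    unfolding S C M .
qed

text \<open>This is the first-order part of the three binomial expansions together. The second
  moments cancel, and the outer factor \<open>(q - 1) / q\<^sup>2\<close> then leaves exactly
  \<open>x\<close>.\<close>

lemma linear_coefficient:
  "2 * square_coeff x z + (real q - 2) * cross_coeff x z - 2 * real q * mean_coeff x =
    (real q)\<^sup>2 / (real q - 1) * x"
  using q3 unfolding square_coeff_def cross_coeff_def mean_coeff_def
  by (simp add: divide_simps) (simp add: algebra_simps power2_eq_square)

end

theorem theorem6:
  fixes q a n d_max :: nat and p lam d_bar :: real and d :: "nat pmf" and x z :: "nat \<Rightarrow> real"
  assumes q: "q \<ge> 3"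
    and p: "p \<in> {0..1}"
    and a: "a \<in> {1..q}"
    and lam: "lam = 1 - p * real q / (real q - 1)"
    and d_bounded: "finite (set_pmf d)"
    and d_bar: "d_bar = measure_pmf.expectation d real"
    and d_max: "d_max = Max (set_pmf d)"
    and x: "\<And>k. x k = x_moment q p d a k"
    and z: "\<And>k. z k = z_moment q p d a k"
    and n: "n \<ge> 1"
  shows "x (n + 1) \<le> d_bar * lam\<^sup>2 * x n
    + (\<Sum>j = 2..d_max. measure_pmf.expectation d (\<lambda>k. real (k choose j)) * lam ^ (2 * j) *
        ( 2 * (real q - 1) / (real q)\<^sup>2
            * (real q * (real q - 3 + lam) / (real q - 1) * x n
               - (real q)\<^sup>2 * lam / (real q - 1) * z n) ^ j
        + (real q - 1) * (real q - 2) / (real q)\<^sup>2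
            * (- (real q * (3 * real q - 6 + 2 * lam) / ((real q - 1) * (real q - 2))) * x n
               + 2 * (real q)\<^sup>2 * lam / ((real q - 1) * (real q - 2)) * z n) ^ j
        - 2 * (real q - 1) / real q * (- (real q / (real q - 1)) * x n) ^ j))"
proof -
  interpret potts q p
    by unfold_locales (use q p in auto)
  have lam': "lam = potts.lam q p"
    by (simp add: lam lam_def)
  have x': "x k = (\<integral>c. tree_x c k \<partial>galton_watson d)" for k
    unfolding x by (rule x_moment_eq[OF a])
  have z': "z k = (\<integral>c. tree_z c k \<partial>galton_watson d)" for k
    unfolding z by (rule z_moment_eq[OF a])
  define s where "s = square_coeff (x n) (z n)"
  define t where "t = cross_coeff (x n) (z n)"
  define u where "u = mean_coeff (x n)"
  define e where "e j = measure_pmf.expectation d (\<lambda>k. real (k choose j))" for j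
  \<comment> \<open>The part of order at least two, of the same form in all three
    expansions.\<close>
  define P where "P w = (\<Sum>j = 2..d_max. e j * (lam\<^sup>2 * w) ^ j)" for w
  have moment: "measure_pmf.expectation d (\<lambda>k. (1 + lam\<^sup>2 * w) ^ k) = 1 + d_bar * (lam\<^sup>2 * w) + P w" for w
    using expectation_one_plus_power[OF d_bounded, of d_max "lam\<^sup>2 * w"] d_bounded
    by (simp add: d_max d_bar P_def e_def)
  have "x (n + 1) \<le> (real q - 1) / real q + (real q - 1) / (real q)\<^sup>2 *
      (2 * (1 + d_bar * (lam\<^sup>2 * s) + P s) + (real q - 2) * (1 + d_bar * (lam\<^sup>2 * t) + P t)
       - 2 * real q * (1 + d_bar * (lam\<^sup>2 * u) + P u))"
    using expected_tree_x_Suc_le[OF d_bounded, of n]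
    unfolding x'[symmetric] z'[symmetric] lam'[symmetric] moment s_def t_def u_def by simp
  \<comment> \<open>The constants cancel, since \<open>2 + (q - 2) - 2 * q = - q\<close>; the rest
    splits into first order and higher orders.\<close>
  also have "\<dots> = d_bar * lam\<^sup>2 * ((real q - 1) / (real q)\<^sup>2 * (2 * s + (real q - 2) * t - 2 * real q * u))
      + (real q - 1) / (real q)\<^sup>2 * (2 * P s + (real q - 2) * P t - 2 * real q * P u)"
    using q by (simp add: divide_simps) (simp add: algebra_simps power2_eq_square)
  also have "(real q - 1) / (real q)\<^sup>2 * (2 * s + (real q - 2) * t - 2 * real q * u) = x n"
    unfolding s_def t_def u_def linear_coefficient using q by simp
  also have "(real q - 1) / (real q)\<^sup>2 * (2 * P s + (real q - 2) * P t - 2 * real q * P u) =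
      (\<Sum>j = 2..d_max. e j * lam ^ (2 * j) * (2 * (real q - 1) / (real q)\<^sup>2 * s ^ j
        + (real q - 1) * (real q - 2) / (real q)\<^sup>2 * t ^ j - 2 * (real q - 1) / real q * u ^ j))"
  proof -
    have "e j * lam ^ (2 * j) * (2 * (real q - 1) / (real q)\<^sup>2 * s ^ j
        + (real q - 1) * (real q - 2) / (real q)\<^sup>2 * t ^ j - 2 * (real q - 1) / real q * u ^ j) =
      (real q - 1) / (real q)\<^sup>2 * (2 * (e j * (lam\<^sup>2 * s) ^ j) + (real q - 2) * (e j * (lam\<^sup>2 * t) ^ j)
        - 2 * real q * (e j * (lam\<^sup>2 * u) ^ j))" for j
      using q unfolding power_mult power_mult_distrib
      by (simp add: divide_simps) (simp add: algebra_simps power2_eq_square)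
    then show ?thesis
      by (simp only: P_def sum_distrib_left sum_subtractf [symmetric] sum.distrib [symmetric])
  qed
  finally show ?thesis
    unfolding e_def s_def t_def u_def square_coeff_def cross_coeff_def mean_coeff_def lam'[symmetric] .
qed

end
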